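(* Fix $p\in[2,\infty)$ and $k,m\in\mathbb N$ with $m\ge k^{1/p}/\sqrt p$. Fix also an integer $n\ge k$. Then for every $f:\mathbb Z_{8m}^n\to L_p$, $$\frac kn\sum_{j=1}^n\frac{\mathbb E\big[\|f(x+4me_j)-f(x)\|_p^p\big]}{m^p}+\Big(\frac kn\Big)^{p/2}\mathbb E\big[\|f(x+\varepsilon)-f(x-\varepsilon)\|_p^p\big]\lesssim_p\frac{p^{p/2}}{\binom nk}\sum_{\substack{S\subset\{1,\ldots,n\}\\|S|=k}}\mathbb E\big[\|f(x+\varepsilon_S)-f(x)\|_p^p\big],$$ where the expectations are with respect to $(x,\varepsilon)\in\mathbb Z_{8m}^n\times\{-1,1\}^n$ chosen uniformly at random.
   Context: $L_p=L_p([0,1])$. $\mathbb Z_M^n=(\mathbb Z/M\mathbb Z)^n$, integer vectors added modulo $M$. $e_j$ standard basis vectors; $\varepsilon_S=\sum_{j\in S}\varepsilon_je_j$. Notation: $a\lesssim_p b$ means $a\le c^pb$ for a universal constant $c\in(0,\infty)$. *)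

theory Defs
  imports "HOL-Analysis.Analysis"
begin

definition torus :: "nat \<Rightarrow> nat \<Rightarrow> (nat \<Rightarrow> int) set" where
  "torus M n = (\<Pi>\<^sub>E i\<in>{..<n}. {0..<int M})"

definition cube :: "nat \<Rightarrow> (nat \<Rightarrow> int) set" where
  "cube n = (\<Pi>\<^sub>E i\<in>{..<n}. {-1, 1})"

definition tadd :: "nat \<Rightarrow> nat \<Rightarrow> (nat \<Rightarrow> int) \<Rightarrow> (nat \<Rightarrow> int) \<Rightarrow> (nat \<Rightarrow> int)" where
  "tadd M n x y = restrict (\<lambda>i. (x i + y i) mod int M) {..<n}"

definition tsub :: "nat \<Rightarrow> nat \<Rightarrow> (nat \<Rightarrow> int) \<Rightarrow> (nat \<Rightarrow> int) \<Rightarrow> (nat \<Rightarrow> int)" where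
  "tsub M n x y = restrict (\<lambda>i. (x i - y i) mod int M) {..<n}"

definition svec :: "nat \<Rightarrow> int \<Rightarrow> nat \<Rightarrow> (nat \<Rightarrow> int)" where
  "svec n c j = restrict (\<lambda>i. if i = j then c else 0) {..<n}"

definition epsS :: "nat \<Rightarrow> (nat \<Rightarrow> int) \<Rightarrow> nat set \<Rightarrow> (nat \<Rightarrow> int)" where
  "epsS n \<epsilon> S = restrict (\<lambda>j. if j \<in> S then \<epsilon> j else 0) {..<n}"

definition avg :: "'a set \<Rightarrow> ('a \<Rightarrow> real) \<Rightarrow> real" where
  "avg A g = (\<Sum>a\<in>A. g a) / real (card A)"

definition in_Lp :: "real \<Rightarrow> (real \<Rightarrow> real) \<Rightarrow> bool" where
  "in_Lp p g \<longleftrightarrow> g \<in> borel_measurable (lebesgue_on {0..1})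
      \<and> integrable (lebesgue_on {0..1}) (\<lambda>t. \<bar>g t\<bar> powr p)"

definition Lp_dist_pow :: "real \<Rightarrow> (real \<Rightarrow> real) \<Rightarrow> (real \<Rightarrow> real) \<Rightarrow> real" where
  "Lp_dist_pow p g h = (LINT t|lebesgue_on {0..1}. \<bar>g t - h t\<bar> powr p)"

end

theory Submission
  imports Defs "HOL-Library.Function_Algebras" "HOL-Combinatorics.Permutations"
begin

text \<open>
  Both sides are integrals over \<open>t \<in> [0,1]\<close>, so it suffices to treat real-valued \<open>f\<close>.

  For the antipodal term, cover \<open>{..<n}\<close> by \<open>N \<le> 2n/k\<close> sets \<open>S\<^sub>i\<close> of size \<open>k\<close> and reveal
  the signs of \<open>\<epsilon>\<close> set by set. The function \<open>\<epsilon> \<mapsto> f(x + \<epsilon>)\<close> minus its mean becomes a sum of \<open>N\<close>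
  martingale differences, and the 2-smoothness of \<open>L\<^sub>p\<close> with constant of order \<open>p\<close> bounds
  its \<open>p\<close>-th moment by \<open>(Cp)\<^bsup>p/2\<^esup> N\<^bsup>p/2-1\<^esup>\<close> times the sum of their \<open>p\<close>-th moments. The \<open>i\<close>-th
  difference is dominated by the effect of resampling the signs in \<open>S\<^sub>i\<close>; passing through
  \<open>x + \<epsilon> - \<epsilon>\<^sub>S\<close> with \<open>S = S\<^sub>i\<close> this costs two increments of the form \<open>f(x + \<epsilon>\<^sub>S) - f(x)\<close>. Averaging
  over the permutations of the cover makes \<open>S\<close> uniform.

  For the axis term, fix \<open>S\<close> with \<open>j \<in> S\<close> and replace \<open>f\<close> by its average over the signs in
  \<open>S - {j}\<close>. The error is two increments, for each of the \<open>k\<close> indices \<open>j\<close>, and \<open>k \<le> m\<^sup>p p\<^bsup>p/2\<^esup>\<close>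
  absorbs it. The averaged function changes along \<open>2 e\<^sub>j\<close> by twice a degree-one Fourier
  coefficient of \<open>\<epsilon> \<mapsto> f(x + \<epsilon>\<^sub>S) - f(x)\<close>, and Bessel's inequality bounds the \<open>\<ell>\<^sub>p\<close> norm of these
  coefficients with no loss.
\<close>

section \<open>Moments of averages\<close>

text \<open>If neither point is 0, \<open>powr_convex\<close> applies; if one is 0, the inequality
  reduces to s^p \<le> s for 0 \<le> s \<le> 1.\<close>

lemma powr_convex_nonneg:
  assumes "p \<ge> 1" shows "convex_on {0..} (\<lambda>x::real. x powr p)"
proof (rule convex_onI)
  have aux: "(s * y) powr p \<le> s * y powr p" if "0 \<le> s" "s \<le> 1" "0 \<le> y" for s y :: real
  proof -
    have "s powr p \<le> s powr 1" if "s > 0"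
      using that \<open>s \<le> 1\<close> assms by (intro powr_mono') auto
    then have "s powr p \<le> s"
      using \<open>0 \<le> s\<close> assms by (cases "s = 0") auto
    then show ?thesis
      using that by (simp add: powr_mult mult_right_mono)
  qed
  fix t x y :: real
  assume t: "0 < t" "t < 1" and xy: "x \<in> {0..}" "y \<in> {0..}"
  show "((1 - t) *\<^sub>R x + t *\<^sub>R y) powr p \<le> (1 - t) * x powr p + t * y powr p"
  proof (cases "x = 0 \<or> y = 0")
    case True
    then show ?thesis
      using t xy assms aux[of t y] aux[of "1 - t" x] by auto
  next
    case False
    then show ?thesis
      using convex_onD[OF powr_convex[OF assms], of t x y] t xy by auto
  qed
qed auto

lemma avg_mono: "(\<And>a. a \<in> A \<Longrightarrow> g a \<le> h a) \<Longrightarrow> avg A g \<le> avg A h"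
  by (simp add: avg_def divide_right_mono sum_mono)

lemma avg_cong: "(\<And>a. a \<in> A \<Longrightarrow> g a = h a) \<Longrightarrow> avg A g = avg A h"
  by (simp add: avg_def)

lemma avg_nonneg: "(\<And>a. a \<in> A \<Longrightarrow> 0 \<le> g a) \<Longrightarrow> 0 \<le> avg A g"
  by (simp add: avg_def sum_nonneg)

lemma avg_add: "avg A (\<lambda>a. g a + h a) = avg A g + avg A h"
  by (simp add: avg_def sum.distrib add_divide_distrib)

lemma avg_diff: "avg A (\<lambda>a. g a - h a) = avg A g - avg A h"
  by (simp add: avg_def sum_subtractf diff_divide_distrib)

lemma avg_cmult: "avg A (\<lambda>a. c * g a) = c * avg A g"
  by (simp add: avg_def sum_distrib_left[symmetric])

lemma avg_const: "finite A \<Longrightarrow> A \<noteq> {} \<Longrightarrow> avg A (\<lambda>a. c) = c"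
  by (simp add: avg_def)

lemma avg_sum: "avg A (\<lambda>a. \<Sum>i\<in>I. g i a) = (\<Sum>i\<in>I. avg A (g i))"
  unfolding avg_def by (subst sum.swap) (simp add: sum_divide_distrib)

lemma avg_swap: "avg A (\<lambda>a. avg B (g a)) = avg B (\<lambda>b. avg A (\<lambda>a. g a b))"
  unfolding avg_def by (simp add: sum_divide_distrib[symmetric] sum.swap[of _ B A] ac_simps)

lemma avg_Times: "avg (A \<times> B) (\<lambda>(a, b). g a b) = avg A (\<lambda>a. avg B (g a))"
  by (simp add: avg_def sum.cartesian_product[symmetric] sum_divide_distrib[symmetric]
      card_cartesian_product ac_simps)

lemma avg_bij: "bij_betw h A B \<Longrightarrow> avg A (\<lambda>a. g (h a)) = avg B g"
  unfolding avg_def by (simp add: bij_betw_same_card sum.reindex_bij_betw)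

lemma avg_jensen:
  assumes "finite A" "A \<noteq> {}" "p \<ge> 1"
  shows "\<bar>avg A g\<bar> powr p \<le> avg A (\<lambda>a. \<bar>g a\<bar> powr p)"
proof -
  have c: "real (card A) > 0" using assms by (simp add: card_gt_0_iff)
  have "\<bar>avg A g\<bar> \<le> (\<Sum>a\<in>A. (1 / card A) * \<bar>g a\<bar>)"
    by (simp add: avg_def sum_divide_distrib[symmetric] divide_right_mono)
  then have "\<bar>avg A g\<bar> powr p \<le> (\<Sum>a\<in>A. (1 / card A) *\<^sub>R \<bar>g a\<bar>) powr p"
    using assms by (intro powr_mono2) auto
  also have "\<dots> \<le> (\<Sum>a\<in>A. (1 / card A) * \<bar>g a\<bar> powr p)"
    using assms c by (intro convex_on_sum[OF _ _ powr_convex_nonneg]) auto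
  also have "\<dots> = avg A (\<lambda>a. \<bar>g a\<bar> powr p)"
    by (simp add: avg_def sum_divide_distrib)
  finally show ?thesis .
qed

lemma sum_powr_le:
  fixes g :: "'a \<Rightarrow> real"
  assumes "finite A" "A \<noteq> {}" "p \<ge> 1"
  shows "\<bar>\<Sum>a\<in>A. g a\<bar> powr p \<le> real (card A) powr (p - 1) * (\<Sum>a\<in>A. \<bar>g a\<bar> powr p)"
proof -
  have c: "real (card A) > 0" using assms by (simp add: card_gt_0_iff)
  have "\<bar>\<Sum>a\<in>A. g a\<bar> powr p = \<bar>real (card A) * avg A g\<bar> powr p"
    using c by (simp add: avg_def)
  also have "\<dots> = real (card A) powr p * \<bar>avg A g\<bar> powr p"
    by (simp add: abs_mult powr_mult)
  also have "\<dots> \<le> real (card A) powr p * avg A (\<lambda>a. \<bar>g a\<bar> powr p)"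
    using avg_jensen[OF assms] by (intro mult_left_mono) auto
  also have "\<dots> = real (card A) powr (p - 1) * (\<Sum>a\<in>A. \<bar>g a\<bar> powr p)"
    using c by (simp add: avg_def powr_diff)
  finally show ?thesis .
qed

lemma abs_add_powr_le:
  fixes x y :: real
  assumes "p \<ge> 1"
  shows "\<bar>x + y\<bar> powr p \<le> 2 powr p * (\<bar>x\<bar> powr p + \<bar>y\<bar> powr p)"
proof -
  have "\<bar>x + y\<bar> powr p \<le> 2 powr (p - 1) * (\<bar>x\<bar> powr p + \<bar>y\<bar> powr p)"
    using sum_powr_le[of "UNIV :: bool set" p "\<lambda>b. if b then x else y"] assms
    by (simp add: UNIV_bool add.commute)
  also have "\<dots> \<le> 2 powr p * (\<bar>x\<bar> powr p + \<bar>y\<bar> powr p)"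
    by (intro mult_right_mono powr_mono) auto
  finally show ?thesis .
qed

lemma abs_add3_powr_le:
  fixes x y z :: real
  assumes "p \<ge> 1"
  shows "\<bar>x + y + z\<bar> powr p \<le> 3 powr p * (\<bar>x\<bar> powr p + \<bar>y\<bar> powr p + \<bar>z\<bar> powr p)"
proof -
  have "\<bar>x + y + z\<bar> powr p \<le> 3 powr (p - 1) * (\<bar>x\<bar> powr p + \<bar>y\<bar> powr p + \<bar>z\<bar> powr p)"
    using sum_powr_le[of "{0, 1, 2 :: nat}" p "\<lambda>i. if i = 0 then x else if i = 1 then y else z"] assms
    by (simp add: ac_simps)
  also have "\<dots> \<le> 3 powr p * (\<bar>x\<bar> powr p + \<bar>y\<bar> powr p + \<bar>z\<bar> powr p)"
    by (intro mult_right_mono powr_mono) auto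
  finally show ?thesis .
qed

section \<open>The two-point inequality\<close>

lemma cosh_le_exp_square: "cosh t \<le> exp (t\<^sup>2)" for t :: real
proof -
  have *: "cosh t \<le> exp (t\<^sup>2)" if "t \<ge> 0" for t :: real
  \<comment> \<open>For small \<open>t\<close> second-order bounds on both exponentials suffice; for
    \<open>t > 1\<close>, already \<open>cosh t \<le> exp t \<le> exp (t\<^sup>2)\<close>.\<close>
  proof (cases "t \<le> 1")
    case True
    have 1: "exp t \<le> 1 + t + t\<^sup>2" using exp_bound that True by blast
    have "exp (- t) \<le> 1 / (1 + t)"
      using that exp_ge_add_one_self[of t] by (simp add: exp_minus field_simps)
    also have "\<dots> \<le> 1 - t + t\<^sup>2"
    proof -
      have "(1 - t + t\<^sup>2) * (1 + t) = 1 + t ^ 3"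
        by (simp add: algebra_simps power2_eq_square power3_eq_cube)
      then show ?thesis
        using that by (simp add: divide_le_eq)
    qed
    finally have "cosh t \<le> 1 + t\<^sup>2"
      using 1 by (simp add: cosh_def)
    then show ?thesis
      using exp_ge_add_one_self[of "t\<^sup>2"] by linarith
  next
    case False
    then have "t \<le> t\<^sup>2" by (simp add: power2_eq_square)
    moreover have "exp (- t) \<le> exp t" using that by simp
    then have "cosh t \<le> exp t" by (simp add: cosh_def)
    ultimately show ?thesis
      by (meson exp_le_cancel_iff order_trans)
  qed
  show ?thesis
    using *[of t] *[of "- t"] by (cases "t \<ge> 0") auto
qed

lemma abs_powr_eq_square_powr: "\<bar>x\<bar> powr p = (x\<^sup>2) powr (p / 2)" for x :: real
proof -
  have "x\<^sup>2 = \<bar>x\<bar> powr 2" by simp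
  then show ?thesis by (simp only: powr_powr) simp
qed

text \<open>The 2-smoothness of L_p in two-point form, normalised to \<open>a = 1\<close>. For small
  \<open>p * b\<^sup>2\<close>, the estimate 1 + c \<le> e^c leads to a hyperbolic cosine; otherwise
  the term \<open>8 * p * b\<^sup>2\<close> dominates each summand separately.\<close>

lemma two_point_one:
  fixes b p :: real
  assumes p: "p \<ge> 2"
  shows "(\<bar>1 + b\<bar> powr p + \<bar>1 - b\<bar> powr p) / 2 \<le> (1 + 8 * p * b\<^sup>2) powr (p / 2)"
proof (cases "p * b\<^sup>2 \<le> 1")
  case True
  moreover have "2 * b\<^sup>2 \<le> p * b\<^sup>2" using p by (intro mult_right_mono) auto
  ultimately have "b\<^sup>2 \<le> 1\<^sup>2" using zero_le_power2[of b] by simp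
  then have b: "\<bar>b\<bar> \<le> 1" using abs_le_square_iff[of b 1] by simp
  have le: "\<bar>1 + c\<bar> powr p \<le> exp (p * c)" if "\<bar>c\<bar> \<le> 1" for c
  proof -
    have "\<bar>1 + c\<bar> powr p \<le> exp c powr p"
      using that p exp_ge_add_one_self[of c] by (intro powr_mono2) auto
    then show ?thesis by (simp add: powr_def mult.commute)
  qed
  have "(\<bar>1 + b\<bar> powr p + \<bar>1 - b\<bar> powr p) / 2 \<le> cosh (p * b)"
    using le[of b] le[of "- b"] b by (simp add: cosh_def)
  also have "\<dots> \<le> exp ((p * b)\<^sup>2)" by (rule cosh_le_exp_square)
  also have "\<dots> = exp (2 * (p * b\<^sup>2)) powr (p / 2)"
    by (simp add: powr_def power2_eq_square)
  also have "\<dots> \<le> (1 + 8 * p * b\<^sup>2) powr (p / 2)"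
  proof (intro powr_mono2)
    \<comment> \<open>The constant 8 arises here: exp(2s) \<le> (1 + 2s)^2 \<le> 1 + 8s on
      [0,1].\<close>
    define s where "s = p * b\<^sup>2"
    have s: "0 \<le> s" "s \<le> 1" using p True by (auto simp: s_def)
    have "exp s \<le> 1 + s + s\<^sup>2" using s by (rule exp_bound)
    also have "s\<^sup>2 \<le> s" using s by (simp add: power2_eq_square mult_left_le)
    finally have "exp s * exp s \<le> (1 + 2 * s) * (1 + 2 * s)"
      using s by (intro mult_mono) auto
    also have "\<dots> = 1 + 4 * s + 4 * s\<^sup>2"
      by (simp add: algebra_simps power2_eq_square)
    also have "\<dots> \<le> 1 + 8 * s"
      using \<open>s\<^sup>2 \<le> s\<close> by simp
    finally show "exp (2 * (p * b\<^sup>2)) \<le> 1 + 8 * p * b\<^sup>2"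
      by (simp add: s_def exp_add[symmetric])
  qed (use p in auto)
  finally show ?thesis .
next
  case False
  have le: "\<bar>1 + c\<bar> powr p \<le> (1 + 8 * p * b\<^sup>2) powr (p / 2)" if "c\<^sup>2 = b\<^sup>2" for c
  proof -
    have "2 * b\<^sup>2 \<le> p * b\<^sup>2" using p by (intro mult_right_mono) auto
    moreover have "0 \<le> (1 - c)\<^sup>2" by simp
    then have "(1 + c)\<^sup>2 \<le> 2 + 2 * c\<^sup>2" by (simp add: power2_eq_square algebra_simps)
    ultimately have "(1 + c)\<^sup>2 \<le> 1 + 8 * p * b\<^sup>2"
      using False that by simp
    then show ?thesis
      using p unfolding abs_powr_eq_square_powr[of "1 + c"] by (intro powr_mono2) auto
  qed
  show ?thesis using le[of b] le[of "- b"] by simp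
qed

text \<open>By homogeneity, dividing by \<open>a\<close> reduces this to
  \<open>two_point_one\<close>.\<close>

lemma two_point:
  fixes a b p :: real
  assumes p: "p \<ge> 2"
  shows "(\<bar>a + b\<bar> powr p + \<bar>a - b\<bar> powr p) / 2 \<le> (a\<^sup>2 + 8 * p * b\<^sup>2) powr (p / 2)"
proof (cases "a = 0")
  case True
  have "b\<^sup>2 \<le> 8 * p * b\<^sup>2"
    using p mult_right_mono[of 1 "8 * p" "b\<^sup>2"] by simp
  then show ?thesis
    using True p by (simp add: abs_powr_eq_square_powr[of b] powr_mono2)
next
  case False
  define c where "c = b / a"
  have b: "b = a * c" using False by (simp add: c_def)
  have "(\<bar>a + b\<bar> powr p + \<bar>a - b\<bar> powr p) / 2
      = \<bar>a\<bar> powr p * ((\<bar>1 + c\<bar> powr p + \<bar>1 - c\<bar> powr p) / 2)"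
  proof -
    have "a + b = a * (1 + c)" "a - b = a * (1 - c)" by (auto simp: b algebra_simps)
    then show ?thesis by (simp only: abs_mult powr_mult abs_ge_zero) (simp add: algebra_simps)
  qed
  also have "\<dots> \<le> \<bar>a\<bar> powr p * (1 + 8 * p * c\<^sup>2) powr (p / 2)"
    using two_point_one[OF p] by (intro mult_left_mono) auto
  also have "\<dots> = (a\<^sup>2 * (1 + 8 * p * c\<^sup>2)) powr (p / 2)"
    using p by (simp add: abs_powr_eq_square_powr[of a] powr_mult)
  also have "a\<^sup>2 * (1 + 8 * p * c\<^sup>2) = a\<^sup>2 + 8 * p * b\<^sup>2"
    by (simp add: b algebra_simps power_mult_distrib)
  finally show ?thesis .
qed

text \<open>Convexity with weights \<open>i / (i + 1)\<close> and \<open>1 / (i + 1)\<close>. At \<open>i = 0\<close> the right-hand side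
  contains \<open>0 / 0 = 0\<close>, whence the last hypothesis.\<close>

lemma add_powr_le_weighted:
  fixes u v q :: real and i :: nat
  assumes "q \<ge> 1" "u \<ge> 0" "v \<ge> 0" "i = 0 \<Longrightarrow> u = 0"
  shows "(u + v) powr q \<le> real (Suc i) powr (q - 1) * (u powr q / real i powr (q - 1) + v powr q)"
proof (cases "i = 0")
  case True
  then show ?thesis using assms by simp
next
  case False
  define l where "l = real i / real (Suc i)"
  have l: "0 < l" "1 - l = 1 / real (Suc i)" "l < 1"
    using False by (auto simp: l_def field_simps)
  have "u + v = (1 - l) *\<^sub>R (real (Suc i) * v) + l *\<^sub>R (u / l)"
    using l False by simp
  then have "(u + v) powr q \<le> (1 - l) * (real (Suc i) * v) powr q + l * (u / l) powr q"
    using convex_onD[OF powr_convex_nonneg[OF assms(1)], of l "real (Suc i) * v" "u / l"] l assms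
    by (simp add: add.commute del: of_nat_Suc)
  also have "(1 - l) * (real (Suc i) * v) powr q = real (Suc i) powr (q - 1) * v powr q"
    using assms by (simp add: l powr_mult powr_diff)
  also have "l * (u / l) powr q = real (Suc i) powr (q - 1) * (u powr q / real i powr (q - 1))"
    using assms False by (simp add: l_def powr_mult powr_divide powr_diff)
  finally show ?thesis by (simp add: algebra_simps)
qed

text \<open>Symmetrisation: \<open>g b\<close> is the mean of \<open>\<mu> + (g b - g b')\<close> over \<open>b'\<close>, and
  exchanging \<open>b\<close> and \<open>b'\<close> changes the sign of the second summand.\<close>

lemma avg_powr_le_square_function:
  fixes g :: "'b \<Rightarrow> real"
  assumes B: "finite B" "B \<noteq> {}" and p: "p \<ge> 2"
  defines "\<mu> \<equiv> avg B g"
  shows "avg B (\<lambda>b. \<bar>g b\<bar> powr p)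
    \<le> avg B (\<lambda>b. avg B (\<lambda>b'. (\<mu>\<^sup>2 + 8 * p * (g b - g b')\<^sup>2) powr (p / 2)))"
proof -
  let ?P = "\<lambda>b b'. \<bar>\<mu> + (g b - g b')\<bar> powr p"
  have 1: "avg B (\<lambda>b. \<bar>g b\<bar> powr p) \<le> avg B (\<lambda>b. avg B (?P b))"
  proof (rule avg_mono)
    fix b
    have "avg B (\<lambda>b'. \<mu> + (g b - g b')) = g b"
      using B by (simp add: avg_add avg_diff avg_const \<mu>_def)
    then show "\<bar>g b\<bar> powr p \<le> avg B (?P b)"
      using avg_jensen[OF B, of p "\<lambda>b'. \<mu> + (g b - g b')"] p by simp
  qed
  have "avg B (\<lambda>b. avg B (?P b)) = avg B (\<lambda>b. avg B (\<lambda>b'. ?P b' b))"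
    by (rule avg_swap)
  then have "avg B (\<lambda>b. avg B (?P b)) = avg B (\<lambda>b. avg B (\<lambda>b'. 1 / 2 * (?P b b' + ?P b' b)))"
    by (simp only: avg_cmult avg_add) simp
  also have "\<dots> \<le> avg B (\<lambda>b. avg B (\<lambda>b'. (\<mu>\<^sup>2 + 8 * p * (g b - g b')\<^sup>2) powr (p / 2)))"
  proof (intro avg_mono)
    fix b b'
    have "\<mu> + (g b' - g b) = \<mu> - (g b - g b')" by simp
    then show "1 / 2 * (?P b b' + ?P b' b) \<le> (\<mu>\<^sup>2 + 8 * p * (g b - g b')\<^sup>2) powr (p / 2)"
      using two_point[OF p, of \<mu> "g b - g b'"] by (simp only: mult_1 times_divide_eq_left)
  qed
  finally show ?thesis using 1 by simp
qed

section \<open>Martingale differences on the cube\<close>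

lemma finite_cube [simp]: "finite (cube n)"
  unfolding cube_def by (intro finite_PiE) auto

lemma cube_nonempty [simp]: "cube n \<noteq> {}"
  unfolding cube_def by (auto simp: PiE_eq_empty_iff)

lemma override_on_cube: "e \<in> cube n \<Longrightarrow> d \<in> cube n \<Longrightarrow> override_on e d R \<in> cube n"
  by (auto simp: cube_def override_on_def PiE_def Pi_def extensional_def)

lemma override_on_cube_full:
  "e \<in> cube n \<Longrightarrow> d \<in> cube n \<Longrightarrow> {..<n} \<subseteq> U \<Longrightarrow> override_on d e U = e"
  by (rule ext) (metis PiE_arb cube_def override_on_apply_in override_on_apply_notin subsetD)

text \<open>Exchanging the coordinates in \<open>R\<close> between two independent uniform points is
  an involution of the product of the two cubes.\<close>

lemma avg_cube_swap:
  "avg (cube n) (\<lambda>e. avg (cube n) (\<lambda>d. \<phi> (override_on e d R) (override_on d e R)))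
    = avg (cube n) (\<lambda>e. avg (cube n) (\<phi> e))"
proof -
  let ?h = "\<lambda>(e, d). (override_on e d R, override_on d e R)"
  have "?h (?h z) = z" for z :: "(nat \<Rightarrow> int) \<times> (nat \<Rightarrow> int)"
    by (cases z) (auto simp: override_on_def fun_eq_iff)
  then have "bij_betw ?h (cube n \<times> cube n) (cube n \<times> cube n)"
    by (intro bij_betw_byWitness[where f' = ?h]) (auto simp: override_on_cube)
  from avg_bij[OF this, of "\<lambda>(e, d). \<phi> e d"] show ?thesis
    unfolding avg_Times[symmetric] by (simp add: case_prod_unfold)
qed

text \<open>Resampling the coordinates in \<open>R\<close> preserves the uniform distribution; this
  is the tool for all conditioning arguments below.\<close>

lemma avg_cube_override:
  "avg (cube n) (\<lambda>e. avg (cube n) (\<lambda>d. \<phi> (override_on e d R))) = avg (cube n) \<phi>"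
  using avg_cube_swap[of n "\<lambda>e d. \<phi> e" R] by (simp add: avg_const)

text \<open>Revealing the coordinates in \<open>S 0\<close>, \<open>S 1\<close>, ... successively turns \<open>F\<close> into a
  martingale \<open>M\<close>. Given \<open>M i\<close>, the two-point inequality bounds the conditional \<open>p\<close>-th moment
  of \<open>M (Suc i)\<close>; the weights \<open>i / (i + 1)\<close> and \<open>1 / (i + 1)\<close> make the induction close.\<close>

lemma cube_martingale_bound:
  fixes F :: "(nat \<Rightarrow> int) \<Rightarrow> real" and S :: "nat \<Rightarrow> nat set"
  assumes p: "p \<ge> 2" and F0: "avg (cube n) F = 0"
  defines "U \<equiv> \<lambda>i. \<Union>j<i. S j"
  defines "M \<equiv> \<lambda>i e. avg (cube n) (\<lambda>d. F (override_on d e (U i)))"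
  defines "B \<equiv> \<lambda>i. avg (cube n) (\<lambda>e. avg (cube n)
    (\<lambda>d. \<bar>F e - F (override_on e d (S i - U i))\<bar> powr p))"
  shows "avg (cube n) (\<lambda>e. \<bar>M i e\<bar> powr p)
    \<le> real i powr (p / 2 - 1) * ((8 * p) powr (p / 2) * (\<Sum>j<i. B j))"
proof (induction i)
  case 0
  have "M 0 e = 0" for e
    using F0 by (simp add: M_def U_def override_on_def)
  then show ?case using p by (simp add: avg_const)
next
  case (Suc i)
  define R where "R = S i - U i"
  have U_Suc: "U (Suc i) = U i \<union> R" and disj: "U i \<inter> R = {}"
    by (auto simp: U_def R_def less_Suc_eq)
  let ?C = "cube n" and ?q = "p / 2" and ?K = "(8 * p) powr (p / 2)"
  let ?g = "\<lambda>e d. M (Suc i) (override_on e d R)"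
  let ?w = "real (Suc i) powr (?q - 1)"

  \<comment> \<open>The martingale property: averaging out the newly revealed block \<open>R\<close>
    returns \<open>M i\<close>.\<close>
  have mean: "avg ?C (?g e) = M i e" for e
  proof -
    have "override_on d' (override_on e d R) (U (Suc i)) = override_on (override_on d' d R) e (U i)"
      for d d' using disj by (auto simp: U_Suc override_on_def fun_eq_iff)
    then have "avg ?C (?g e)
        = avg ?C (\<lambda>d. avg ?C (\<lambda>d'. F (override_on (override_on d' d R) e (U i))))"
      by (simp add: M_def)
    also have "\<dots> = avg ?C (\<lambda>d'. avg ?C (\<lambda>d. F (override_on (override_on d' d R) e (U i))))"
      by (rule avg_swap)
    also have "\<dots> = M i e"
      unfolding M_def by (rule avg_cube_override)
    finally show ?thesis .
  qed

  \<comment> \<open>The hypothesis of \<open>add_powr_le_weighted\<close> for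
    \<open>i = 0\<close>.\<close>
  have M0: "M 0 e = 0" for e
    using F0 by (simp add: M_def U_def override_on_def)
  have pointwise: "avg ?C (\<lambda>d. \<bar>?g e d\<bar> powr p)
      \<le> ?w * (\<bar>M i e\<bar> powr p / real i powr (?q - 1)
          + ?K * avg ?C (\<lambda>d. avg ?C (\<lambda>d'. \<bar>?g e d - ?g e d'\<bar> powr p)))" for e
  proof -
    have "avg ?C (\<lambda>d. \<bar>?g e d\<bar> powr p)
        \<le> avg ?C (\<lambda>d. avg ?C (\<lambda>d'. ((M i e)\<^sup>2 + 8 * p * (?g e d - ?g e d')\<^sup>2) powr ?q))"
      using avg_powr_le_square_function[of ?C p "?g e"] p by (simp add: mean)
    also have "\<dots> \<le> avg ?C (\<lambda>d. avg ?C (\<lambda>d'. ?w * (\<bar>M i e\<bar> powr p / real i powr (?q - 1)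
          + ?K * \<bar>?g e d - ?g e d'\<bar> powr p)))"
    proof (intro avg_mono)
      fix d d'
      have "((M i e)\<^sup>2 + 8 * p * (?g e d - ?g e d')\<^sup>2) powr ?q
          \<le> ?w * (((M i e)\<^sup>2) powr ?q / real i powr (?q - 1)
            + (8 * p * (?g e d - ?g e d')\<^sup>2) powr ?q)"
        using p M0[of e] by (intro add_powr_le_weighted) auto
      then show "((M i e)\<^sup>2 + 8 * p * (?g e d - ?g e d')\<^sup>2) powr ?q
          \<le> ?w * (\<bar>M i e\<bar> powr p / real i powr (?q - 1) + ?K * \<bar>?g e d - ?g e d'\<bar> powr p)"
        using p by (simp add: abs_powr_eq_square_powr[of _ p] powr_mult)
    qed
    also have "\<dots> = ?w * (\<bar>M i e\<bar> powr p / real i powr (?q - 1)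
          + ?K * avg ?C (\<lambda>d. avg ?C (\<lambda>d'. \<bar>?g e d - ?g e d'\<bar> powr p)))"
      by (simp add: avg_cmult avg_add avg_const del: of_nat_Suc)
    finally show ?thesis .
  qed

  have diff: "avg ?C (\<lambda>e. avg ?C (\<lambda>d. avg ?C (\<lambda>d'. \<bar>?g e d - ?g e d'\<bar> powr p))) \<le> B i"
  proof -
    let ?V = "U (Suc i)"
    \<comment> \<open>Since \<open>d'\<close> overwrites \<open>d\<close> on \<open>R\<close>,
      everything depends on \<open>e\<close> and \<open>d\<close> through the resampled point only,
      which is again uniform.\<close>
    have "avg ?C (\<lambda>e. avg ?C (\<lambda>d. avg ?C (\<lambda>d'. \<bar>?g e d - ?g e d'\<bar> powr p)))
        = avg ?C (\<lambda>e. avg ?C (\<lambda>d. avg ?C (\<lambda>d'.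
            \<bar>M (Suc i) (override_on e d R) - ?g (override_on e d R) d'\<bar> powr p)))"
    proof -
      have "override_on (override_on e d R) d' R = override_on e d' R" for e d d' :: "nat \<Rightarrow> int"
        by (auto simp: override_on_def)
      then show ?thesis by simp
    qed
    also have "\<dots> = avg ?C (\<lambda>e. avg ?C (\<lambda>d'. \<bar>M (Suc i) e - ?g e d'\<bar> powr p))"
      by (rule avg_cube_override)
    also have "\<dots> \<le> avg ?C (\<lambda>e. avg ?C (\<lambda>d'. avg ?C (\<lambda>d.
        \<bar>F (override_on d e ?V) - F (override_on (override_on d e ?V) d' R)\<bar> powr p)))"
    proof (intro avg_mono)
      fix e d' :: "nat \<Rightarrow> int"
      have *: "override_on d (override_on e d' R) ?V = override_on (override_on d e ?V) d' R" for d
        by (auto simp: U_Suc override_on_def)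
      have "M (Suc i) e - ?g e d'
          = avg ?C (\<lambda>d. F (override_on d e ?V) - F (override_on (override_on d e ?V) d' R))"
        by (simp add: M_def avg_diff *)
      then show "\<bar>M (Suc i) e - ?g e d'\<bar> powr p \<le> avg ?C (\<lambda>d.
          \<bar>F (override_on d e ?V) - F (override_on (override_on d e ?V) d' R)\<bar> powr p)"
        using p avg_jensen[of ?C p "\<lambda>d. F (override_on d e ?V)
          - F (override_on (override_on d e ?V) d' R)"] by simp
    qed
    \<comment> \<open>For independent uniform \<open>d\<close> and \<open>e\<close> the point
      \<open>override_on d e ?V\<close> is uniform, so the average collapses to
      \<open>B i\<close>.\<close>
    also have "\<dots> = avg ?C (\<lambda>d. avg ?C (\<lambda>e. avg ?C (\<lambda>d'.
        \<bar>F (override_on d e ?V) - F (override_on (override_on d e ?V) d' R)\<bar> powr p)))"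
      by (subst avg_swap, subst avg_swap) simp
    also have "\<dots> = B i"
      unfolding B_def R_def by (rule avg_cube_override)
    finally show ?thesis .
  qed

  have "avg ?C (\<lambda>e. \<bar>M (Suc i) e\<bar> powr p) = avg ?C (\<lambda>e. avg ?C (\<lambda>d. \<bar>?g e d\<bar> powr p))"
    by (rule avg_cube_override[symmetric])
  also have "\<dots> \<le> avg ?C (\<lambda>e. ?w * (\<bar>M i e\<bar> powr p / real i powr (?q - 1)
      + ?K * avg ?C (\<lambda>d. avg ?C (\<lambda>d'. \<bar>?g e d - ?g e d'\<bar> powr p))))"
    by (intro avg_mono pointwise)
  also have "\<dots> = ?w * (avg ?C (\<lambda>e. \<bar>M i e\<bar> powr p) / real i powr (?q - 1)
      + ?K * avg ?C (\<lambda>e. avg ?C (\<lambda>d. avg ?C (\<lambda>d'. \<bar>?g e d - ?g e d'\<bar> powr p))))"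
    using avg_cmult[of ?C "1 / real i powr (?q - 1)" "\<lambda>e. \<bar>M i e\<bar> powr p"]
    by (simp add: avg_cmult avg_add)
  also have "\<dots> \<le> ?w * (?K * (\<Sum>j<i. B j) + ?K * B i)"
  proof (intro mult_left_mono add_mono diff)
    show "avg ?C (\<lambda>e. \<bar>M i e\<bar> powr p) / real i powr (?q - 1) \<le> ?K * (\<Sum>j<i. B j)"
    \<comment> \<open>At \<open>i = 0\<close> both sides are 0: \<open>0 powr a\<close> is 0 for
      every \<open>a\<close>, and division by 0 gives 0.\<close>
    proof (cases "i = 0")
      case False
      then show ?thesis using Suc.IH by (simp add: divide_le_eq mult.commute)
    qed simp
  qed auto
  also have "\<dots> = ?w * (?K * (\<Sum>j<Suc i. B j))"
    by (simp add: algebra_simps)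
  finally show ?case .
qed

text \<open>Once the cover is exhausted all signs are revealed, so the last martingale term is
  \<open>F\<close> minus its mean.\<close>

lemma cube_concentration:
  fixes F :: "(nat \<Rightarrow> int) \<Rightarrow> real" and S :: "nat \<Rightarrow> nat set"
  assumes p: "p \<ge> 2" and cover: "{..<n} \<subseteq> (\<Union>j<N. S j)"
  shows "avg (cube n) (\<lambda>e. \<bar>F e - avg (cube n) F\<bar> powr p)
    \<le> real N powr (p / 2 - 1) * ((8 * p) powr (p / 2) *
      (\<Sum>i<N. avg (cube n) (\<lambda>e. avg (cube n)
        (\<lambda>d. \<bar>F e - F (override_on e d (S i - (\<Union>j<i. S j)))\<bar> powr p))))"
proof -
  let ?G = "\<lambda>e. F e - avg (cube n) F"
  have "avg (cube n) ?G = 0"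
    by (simp add: avg_diff avg_const)
  from cube_martingale_bound[OF p this, of S N]
  show ?thesis
    by (subst avg_cong[of "cube n" _ "\<lambda>e. \<bar>avg (cube n) (\<lambda>d. F (override_on d e (\<Union>j<N. S j))
        - avg (cube n) F)\<bar> powr p"])
      (simp_all add: override_on_cube_full[OF _ _ cover] avg_const cong: avg_cong)
qed

section \<open>Fourier coefficients and random subsets\<close>

text \<open>Each term is at most the sum s, hence a^q \<le> a s^(q-1).\<close>

lemma sum_powr_le_powr_sum:
  fixes a :: "'a \<Rightarrow> real"
  assumes "finite A" "q \<ge> 1" "\<And>j. j \<in> A \<Longrightarrow> a j \<ge> 0"
  shows "(\<Sum>j\<in>A. a j powr q) \<le> (\<Sum>j\<in>A. a j) powr q"
proof -
  let ?s = "\<Sum>j\<in>A. a j"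
  have s: "?s \<ge> 0" using assms by (simp add: sum_nonneg)
  have split: "x powr q = x * x powr (q - 1)" if "x \<ge> 0" for x :: real
    using that powr_add[of x 1 "q - 1"] by (cases "x = 0") auto
  have "(\<Sum>j\<in>A. a j powr q) \<le> (\<Sum>j\<in>A. a j * ?s powr (q - 1))"
  proof (intro sum_mono)
    fix j assume j: "j \<in> A"
    have "a j \<le> ?s" using assms j by (intro member_le_sum) auto
    then have "a j * a j powr (q - 1) \<le> a j * ?s powr (q - 1)"
      using assms j by (intro mult_left_mono powr_mono2) auto
    then show "a j powr q \<le> a j * ?s powr (q - 1)"
      using split[of "a j"] assms j by simp
  qed
  also have "\<dots> = ?s powr q"
    using split[OF s] by (simp add: sum_distrib_right)
  finally show ?thesis .
qed

lemma cube_iff: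
  "e \<in> cube n \<longleftrightarrow> (\<forall>i<n. e i = 1 \<or> e i = -1) \<and> (\<forall>i. \<not> i < n \<longrightarrow> e i = undefined)"
  by (auto simp: cube_def PiE_def Pi_def extensional_def)

lemma cube_values: "e \<in> cube n \<Longrightarrow> j < n \<Longrightarrow> e j = 1 \<or> e j = -1"
  by (simp add: cube_iff)

lemma flip_in_cube: "e \<in> cube n \<Longrightarrow> j < n \<Longrightarrow> e(j := - e j) \<in> cube n"
  unfolding cube_iff fun_upd_apply by (metis add.inverse_inverse)

lemma avg_cube_neg:
  "avg (cube n) (\<lambda>e. \<phi> (restrict (- e) {..<n})) = avg (cube n) \<phi>"
proof (rule avg_bij, rule bij_betw_byWitness[where f' = "\<lambda>e. restrict (- e) {..<n}"])
  show "\<forall>e\<in>cube n. restrict (- restrict (- e) {..<n}) {..<n} = e"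
    by (auto simp: cube_iff fun_eq_iff)
  then show "\<forall>e\<in>cube n. restrict (- restrict (- e) {..<n}) {..<n} = e" .
qed (force simp: cube_iff)+

text \<open>Flipping the sign at \<open>j\<close> preserves the average, and a point and its flip
  are the two points with that sign fixed.\<close>

lemma avg_cube_split:
  assumes "j < n"
  shows "avg (cube n) \<phi> = (avg (cube n) (\<lambda>e. \<phi> (e(j := 1))) + avg (cube n) (\<lambda>e. \<phi> (e(j := -1)))) / 2"
proof -
  have "bij_betw (\<lambda>e. e(j := - e j)) (cube n) (cube n)"
    using assms by (intro bij_betw_byWitness[where f' = "\<lambda>e. e(j := - e j)"])
      (auto intro: flip_in_cube)
  then have "avg (cube n) (\<lambda>e. \<phi> (e(j := - e j))) = avg (cube n) \<phi>"
    by (rule avg_bij)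
  then have "2 * avg (cube n) \<phi> = avg (cube n) (\<lambda>e. \<phi> e + \<phi> (e(j := - e j)))"
    by (simp add: avg_add)
  also have "\<dots> = avg (cube n) (\<lambda>e. \<phi> (e(j := 1)) + \<phi> (e(j := -1)))"
  proof (rule avg_cong)
    fix e assume e: "e \<in> cube n"
    have "e j = 1 \<Longrightarrow> e(j := 1) = e" "e j = -1 \<Longrightarrow> e(j := -1) = e"
      by (metis fun_upd_triv)+
    then show "\<phi> e + \<phi> (e(j := - e j)) = \<phi> (e(j := 1)) + \<phi> (e(j := -1))"
      using cube_values[OF e assms] by auto
  qed
  finally show ?thesis by (simp add: avg_add)
qed

lemma avg_cube_fix_le:
  assumes "j < n" "\<And>e. \<phi> e \<ge> 0"
  shows "avg (cube n) (\<lambda>e. \<phi> (e(j := -1))) \<le> 2 * avg (cube n) \<phi>"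
  using avg_cube_split[OF assms(1), of \<phi>] avg_nonneg[of "cube n" "\<lambda>e. \<phi> (e(j := 1))"] assms(2)
  by simp

text \<open>A degree-one Fourier coefficient is half the difference of two conditional means. This
  links it to increments of the averaged function.\<close>

lemma avg_cube_sign:
  "j < n \<Longrightarrow> avg (cube n) (\<lambda>e. real_of_int (e j) * \<phi> e)
    = (avg (cube n) (\<lambda>e. \<phi> (e(j := 1))) - avg (cube n) (\<lambda>e. \<phi> (e(j := -1)))) / 2"
  using avg_cube_split[of j n "\<lambda>e. real_of_int (e j) * \<phi> e"] avg_cmult[of "cube n" "-1"]
  by simp

lemma avg_cube_orthonormal:
  assumes "i < n" "j < n"
  shows "avg (cube n) (\<lambda>e. real_of_int (e i) * real_of_int (e j)) = (if i = j then 1 else 0)"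
proof (cases "i = j")
  case True
  have "avg (cube n) (\<lambda>e. real_of_int (e i) * real_of_int (e j)) = avg (cube n) (\<lambda>e. 1)"
    using True cube_values[OF _ assms(1)] by (intro avg_cong) force
  then show ?thesis using True by (simp add: avg_const)
next
  case False
  then show ?thesis using avg_cube_sign[OF assms(1), of "\<lambda>e. real_of_int (e j)"] by simp
qed

text \<open>Expand the second moment of \<open>h\<close> minus its projection onto the orthonormal
  sign functions.\<close>

lemma bessel_cube:
  fixes h :: "(nat \<Rightarrow> int) \<Rightarrow> real"
  assumes S: "S \<subseteq> {..<n}"
  defines "a \<equiv> \<lambda>j. avg (cube n) (\<lambda>e. real_of_int (e j) * h e)"
  shows "(\<Sum>j\<in>S. (a j)\<^sup>2) \<le> avg (cube n) (\<lambda>e. (h e)\<^sup>2)"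
proof -
  have fin: "finite S" using S finite_subset by blast
  let ?L = "\<lambda>e. \<Sum>j\<in>S. a j * real_of_int (e j)"
  have "avg (cube n) (\<lambda>e. (?L e)\<^sup>2)
      = avg (cube n) (\<lambda>e. \<Sum>i\<in>S. \<Sum>j\<in>S. (a i * a j) * (real_of_int (e i) * real_of_int (e j)))"
    by (simp add: power2_eq_square sum_product ac_simps)
  also have "\<dots> = (\<Sum>i\<in>S. \<Sum>j\<in>S. (a i * a j) * (if i = j then 1 else 0))"
    using S by (simp add: avg_sum avg_cmult avg_cube_orthonormal subset_iff)
  also have "\<dots> = (\<Sum>j\<in>S. (a j)\<^sup>2)"
    using fin by (simp add: power2_eq_square if_distrib cong: if_cong)
  finally have LL: "avg (cube n) (\<lambda>e. (?L e)\<^sup>2) = (\<Sum>j\<in>S. (a j)\<^sup>2)" .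
  have "avg (cube n) (\<lambda>e. ?L e * h e)
      = avg (cube n) (\<lambda>e. \<Sum>j\<in>S. a j * (real_of_int (e j) * h e))"
    by (simp add: sum_distrib_right mult.assoc)
  also have "\<dots> = (\<Sum>j\<in>S. (a j)\<^sup>2)"
    by (simp add: avg_sum avg_cmult power2_eq_square a_def)
  finally have Lh: "avg (cube n) (\<lambda>e. ?L e * h e) = (\<Sum>j\<in>S. (a j)\<^sup>2)" .
  have "0 \<le> avg (cube n) (\<lambda>e. (h e - ?L e)\<^sup>2)"
    by (intro avg_nonneg) auto
  also have "\<dots> = avg (cube n) (\<lambda>e. (h e)\<^sup>2 - 2 * (?L e * h e) + (?L e)\<^sup>2)"
    by (simp add: power2_diff algebra_simps)
  also have "\<dots> = avg (cube n) (\<lambda>e. (h e)\<^sup>2) - (\<Sum>j\<in>S. (a j)\<^sup>2)"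
    by (simp add: avg_add avg_diff avg_cmult LL Lh)
  finally show ?thesis by simp
qed

text \<open>The l_p norm is at most the l_2 norm; then Bessel and Jensen with exponent
  \<open>p / 2\<close> apply, all with constant 1.\<close>

lemma cube_cotype:
  fixes h :: "(nat \<Rightarrow> int) \<Rightarrow> real"
  assumes S: "S \<subseteq> {..<n}" and p: "p \<ge> 2"
  shows "(\<Sum>j\<in>S. \<bar>avg (cube n) (\<lambda>e. real_of_int (e j) * h e)\<bar> powr p)
    \<le> avg (cube n) (\<lambda>e. \<bar>h e\<bar> powr p)"
proof -
  let ?a = "\<lambda>j. avg (cube n) (\<lambda>e. real_of_int (e j) * h e)"
  have "(\<Sum>j\<in>S. \<bar>?a j\<bar> powr p) = (\<Sum>j\<in>S. ((?a j)\<^sup>2) powr (p / 2))"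
    by (simp only: abs_powr_eq_square_powr)
  also have "\<dots> \<le> (\<Sum>j\<in>S. (?a j)\<^sup>2) powr (p / 2)"
    using S p finite_subset[OF S] by (intro sum_powr_le_powr_sum) auto
  also have "\<dots> \<le> avg (cube n) (\<lambda>e. (h e)\<^sup>2) powr (p / 2)"
    using p by (intro powr_mono2 bessel_cube[OF S] sum_nonneg) auto
  also have "\<dots> \<le> avg (cube n) (\<lambda>e. \<bar>(h e)\<^sup>2\<bar> powr (p / 2))"
    using avg_jensen[of "cube n" "p / 2" "\<lambda>e. (h e)\<^sup>2"] p
    by (simp add: avg_nonneg)
  also have "\<dots> = avg (cube n) (\<lambda>e. \<bar>h e\<bar> powr p)"
    by (simp add: abs_powr_eq_square_powr[of _ p])
  finally show ?thesis .
qed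

section \<open>Permutations, covers and uniform k-subsets\<close>

lemma permutes_onto_subset:
  assumes "finite A" "S \<subseteq> A" "S' \<subseteq> A" "card S = card S'"
  obtains \<tau> where "\<tau> permutes A" "\<tau> ` S = S'"
proof -
  have fin: "finite S" "finite S'" using assms finite_subset by auto
  obtain f where f: "bij_betw f S S'"
    using assms fin finite_same_card_bij by blast
  obtain g where g: "bij_betw g (A - S) (A - S')"
    using assms fin finite_same_card_bij[of "A - S" "A - S'"] by (auto simp: card_Diff_subset)
  define \<tau> where "\<tau> x = (if x \<in> S then f x else if x \<in> A then g x else x)" for x
  have 1: "bij_betw \<tau> S S'"
    using f by (subst bij_betw_cong[of _ _ f]) (auto simp: \<tau>_def)
  have "bij_betw \<tau> (A - S) (A - S')"
    using g by (subst bij_betw_cong[of _ _ g]) (auto simp: \<tau>_def)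
  from bij_betw_combine[OF 1 this] have "bij_betw \<tau> A A"
    using assms by (simp add: Un_absorb1 Int_Diff)
  then have "\<tau> permutes A"
    using assms by (intro bij_imp_permutes) (auto simp: \<tau>_def)
  moreover have "\<tau> ` S = S'" using 1 by (simp add: bij_betw_def)
  ultimately show thesis using that by blast
qed

text \<open>The left-hand side depends only on \<open>card S0\<close>, so it may also be averaged over \<open>S0\<close>.\<close>

lemma avg_permutes_image:
  fixes g :: "'a set \<Rightarrow> real"
  assumes A: "finite A" and S0: "S0 \<subseteq> A" "card S0 = k"
  shows "avg {\<pi>. \<pi> permutes A} (\<lambda>\<pi>. g (\<pi> ` S0)) = avg {S. S \<subseteq> A \<and> card S = k} g"
proof -
  let ?P = "{\<pi>. \<pi> permutes A}" and ?K = "{S. S \<subseteq> A \<and> card S = k}"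
  have fin: "finite ?P" "?P \<noteq> {}" "finite ?K" "?K \<noteq> {}"
    using A S0 permutes_id[of A] by (auto simp: finite_permutations simp del: permutes_id)
  have same: "avg ?P (\<lambda>\<pi>. g (\<pi> ` S)) = avg ?P (\<lambda>\<pi>. g (\<pi> ` S0))" if S: "S \<in> ?K" for S
  proof -
    obtain \<tau> where \<tau>: "\<tau> permutes A" "\<tau> ` S0 = S"
      using permutes_onto_subset[of A S0 S] A S0 S by auto
    have "bij_betw (\<lambda>\<pi>. \<pi> \<circ> \<tau>) ?P ?P"
    proof (rule bij_betw_byWitness[where f' = "\<lambda>\<pi>. \<pi> \<circ> inv \<tau>"])
      show "\<forall>\<pi>\<in>?P. \<pi> \<circ> \<tau> \<circ> inv \<tau> = \<pi>" "\<forall>\<pi>\<in>?P. \<pi> \<circ> inv \<tau> \<circ> \<tau> = \<pi>"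
        using \<tau> by (simp_all add: comp_assoc permutes_inv_o)
    qed (use \<tau> in \<open>auto intro: permutes_compose permutes_inv\<close>)
    from avg_bij[OF this, of "\<lambda>\<pi>. g (\<pi> ` S0)"] show ?thesis
      by (simp only: image_comp[symmetric] \<tau>)
  qed
  have perm: "avg ?K (\<lambda>S. g (\<pi> ` S)) = avg ?K g" if \<pi>: "\<pi> permutes A" for \<pi>
  proof (rule avg_bij, rule bij_betw_byWitness[where f' = "\<lambda>S. inv \<pi> ` S"])
    show "\<forall>S\<in>?K. inv \<pi> ` \<pi> ` S = S" "\<forall>S\<in>?K. \<pi> ` inv \<pi> ` S = S"
      using \<pi> by (simp_all add: image_comp permutes_inv_o)
    have "\<sigma> ` S \<in> ?K" if "\<sigma> permutes A" "S \<in> ?K" for \<sigma> S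
      using that by (auto simp: permutes_in_image card_image permutes_inj_on subset_iff)
    then show "(`) \<pi> ` ?K \<subseteq> ?K" "(`) (inv \<pi>) ` ?K \<subseteq> ?K"
      using \<pi> permutes_inv[OF \<pi>] by blast+
  qed
  have "avg ?P (\<lambda>\<pi>. g (\<pi> ` S0)) = avg ?K (\<lambda>S. avg ?P (\<lambda>\<pi>. g (\<pi> ` S)))"
    by (subst avg_cong[OF same]) (use fin in \<open>simp_all add: avg_const\<close>)
  also have "\<dots> = avg ?P (\<lambda>\<pi>. avg ?K (\<lambda>S. g (\<pi> ` S)))" by (rule avg_swap)
  also have "\<dots> = avg ?K g"
    by (subst avg_cong[OF perm]) (use fin in \<open>simp_all add: avg_const\<close>)
  finally show ?thesis .
qed

text \<open>Take consecutive blocks, with the starting point capped at \<open>n - k\<close> so that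
  the last one fits; overlaps are allowed. Their total size is at most n + k \<le> 2n.\<close>

lemma cover_by_k_sets:
  assumes "1 \<le> k" "k \<le> n"
  obtains S :: "nat \<Rightarrow> nat set" and N
  where "N > 0" "N * k \<le> 2 * n" "{..<n} = (\<Union>i<N. S i)"
    "\<And>i. S i \<subseteq> {..<n} \<and> card (S i) = k"
proof
  let ?S = "\<lambda>i. {min (i * k) (n - k) ..< min (i * k) (n - k) + k}"
  show "n div k + 1 > 0" by simp
  show "(n div k + 1) * k \<le> 2 * n"
    using assms div_times_less_eq_dividend[of n k] by (simp only: add_mult_distrib)
  show S: "?S i \<subseteq> {..<n} \<and> card (?S i) = k" for i
    using assms by auto
  show "{..<n} = (\<Union>i<n div k + 1. ?S i)"
  proof
    show "{..<n} \<subseteq> (\<Union>i<n div k + 1. ?S i)"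
    proof
      fix j assume j: "j \<in> {..<n}"
      have 1: "j div k * k \<le> j" "j < j div k * k + k"
        using assms dividend_less_times_div[of k j] by (auto simp: mult.commute)
      have "j div k < n div k + 1"
        using j by (simp add: div_le_mono less_Suc_eq_le)
      moreover have "j \<in> ?S (j div k)"
        using order_trans[OF min.cobounded1 1(1)] 1(2) j by auto
      ultimately show "j \<in> (\<Union>i<n div k + 1. ?S i)" by blast
    qed
  qed (use S in blast)
qed

text \<open>Each index lies in a uniform k-subset with probability k/n, by the absorption identity
  for binomial coefficients.\<close>

lemma avg_subsets_sum:
  fixes w :: "nat \<Rightarrow> real"
  assumes "1 \<le> k" "k \<le> n"
  shows "avg {S. S \<subseteq> {..<n} \<and> card S = k} (\<lambda>S. \<Sum>j\<in>S. w j) = real k / real n * (\<Sum>j<n. w j)"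
proof -
  let ?K = "{S. S \<subseteq> {..<n} \<and> card S = k}"
  have card_K: "card ?K = n choose k" using n_subsets[of "{..<n}" k] by simp
  have count: "card {S \<in> ?K. j \<in> S} = (n - 1) choose (k - 1)" if j: "j < n" for j
  proof -
    have "bij_betw (insert j) {S. S \<subseteq> {..<n} - {j} \<and> card S = k - 1} {S \<in> ?K. j \<in> S}"
    proof (rule bij_betw_byWitness[where f' = "\<lambda>S. S - {j}"])
      show "insert j ` {S. S \<subseteq> {..<n} - {j} \<and> card S = k - 1} \<subseteq> {S \<in> ?K. j \<in> S}"
      proof (rule image_subsetI)
        fix S assume S: "S \<in> {S. S \<subseteq> {..<n} - {j} \<and> card S = k - 1}"
        then have "finite S" "j \<notin> S" using finite_subset[of S "{..<n}"] by auto
        then show "insert j S \<in> {S \<in> ?K. j \<in> S}" using S j assms by auto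
      qed
    qed (auto simp: card_Diff_singleton)
    then show ?thesis
      using n_subsets[of "{..<n} - {j}" "k - 1"] j by (simp add: bij_betw_same_card[symmetric])
  qed
  have "(\<Sum>S\<in>?K. \<Sum>j\<in>S. w j) = (\<Sum>S\<in>?K. \<Sum>j<n. if j \<in> S then w j else 0)"
  proof (rule sum.cong[OF refl])
    fix S assume "S \<in> ?K"
    then have "{..<n} \<inter> S = S" by auto
    then show "(\<Sum>j\<in>S. w j) = (\<Sum>j<n. if j \<in> S then w j else 0)"
      using sum.inter_restrict[of "{..<n}" w S] by simp
  qed
  also have "\<dots> = (\<Sum>j<n. \<Sum>S\<in>?K. if j \<in> S then w j else 0)" by (rule sum.swap)
  also have "\<dots> = (\<Sum>j<n. real ((n - 1) choose (k - 1)) * w j)"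
    using count by (intro sum.cong refl) (simp add: sum.If_cases Collect_conj_eq[symmetric] Int_def)
  finally have "avg ?K (\<lambda>S. \<Sum>j\<in>S. w j)
      = real ((n - 1) choose (k - 1)) / real (n choose k) * (\<Sum>j<n. w j)"
    by (simp add: avg_def card_K sum_distrib_left[symmetric])
  also have "real ((n - 1) choose (k - 1)) / real (n choose k) = real k / real n"
  proof -
    have "k * (n choose k) = n * ((n - 1) choose (k - 1))"
      using assms binomial_absorption[of "k - 1" "n"] by simp
    then have "real k * real (n choose k) = real n * real ((n - 1) choose (k - 1))"
      by (metis of_nat_mult)
    moreover have "real (n choose k) > 0" using assms by simp
    ultimately show ?thesis using assms by (simp add: field_simps)
  qed
  finally show ?thesis .
qed

section \<open>Functions on the discrete torus\<close>

text \<open>Composing \<open>f\<close> with \<open>torus_rep\<close> extends it to a periodic function on all of \<open>nat \<Rightarrow> int\<close>,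
  where addition is pointwise and no reduction modulo \<open>M\<close> has to be carried along.\<close>

definition torus_rep :: "nat \<Rightarrow> nat \<Rightarrow> (nat \<Rightarrow> int) \<Rightarrow> nat \<Rightarrow> int" where
  "torus_rep M n x = restrict (\<lambda>i. x i mod int M) {..<n}"

text \<open>The counterpart of \<open>epsS\<close> without restriction to \<open>{..<n}\<close>,
  suited to pointwise addition; \<open>tadd_epsS\<close> relates the two.\<close>

definition signed_ind :: "(nat \<Rightarrow> int) \<Rightarrow> nat set \<Rightarrow> nat \<Rightarrow> int" where
  "signed_ind e S = (\<lambda>j. if j \<in> S then e j else 0)"

lemma torus_rep_in: "M > 0 \<Longrightarrow> torus_rep M n x \<in> torus M n"
  by (auto simp: torus_rep_def torus_def)

lemma torus_rep_id: "x \<in> torus M n \<Longrightarrow> torus_rep M n x = x"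
  by (rule ext) (auto simp: torus_rep_def torus_def PiE_def Pi_def extensional_def restrict_def)

lemma torus_rep_add: "torus_rep M n (torus_rep M n x + v) = torus_rep M n (x + v)"
  by (rule ext) (auto simp: torus_rep_def restrict_def mod_simps)

text \<open>Translation permutes the torus, and periodicity of \<open>g\<close> removes the
  reduction modulo \<open>M\<close>.\<close>

lemma avg_torus_shift:
  assumes M: "M > 0" and g: "\<And>x. g (torus_rep M n x) = g x"
  shows "avg (torus M n) (\<lambda>x. g (x + v)) = avg (torus M n) g"
proof -
  have inv: "torus_rep M n (torus_rep M n (x + v) + (- v)) = x" if "x \<in> torus M n" for x v
    using that by (simp only: torus_rep_add) (simp add: torus_rep_id)
  have "bij_betw (\<lambda>x. torus_rep M n (x + v)) (torus M n) (torus M n)"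
  proof (rule bij_betw_byWitness[where f' = "\<lambda>x. torus_rep M n (x + (- v))"])
    show "\<forall>x\<in>torus M n. torus_rep M n (torus_rep M n (x + - v) + v) = x"
      using inv[of _ "- v"] by simp
  qed (use M in \<open>auto simp: inv[simplified] torus_rep_in\<close>)
  from avg_bij[OF this, of g] show ?thesis by (simp add: g)
qed

section \<open>Increments of scalar functions and the antipodal term\<close>

locale torus_function =
  fixes M n :: nat and f :: "(nat \<Rightarrow> int) \<Rightarrow> real" and p :: real
  assumes M: "M > 0" and per: "f (torus_rep M n x) = f x" and p: "p \<ge> 2"
begin

abbreviation "T \<equiv> torus M n"
abbreviation "C \<equiv> cube n"

definition W :: "(nat \<Rightarrow> int) \<Rightarrow> real" where
  "W v = avg T (\<lambda>x. \<bar>f (x + v) - f x\<bar> powr p)"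

text \<open>The summand of the right-hand side belonging to \<open>S\<close>, for scalar
  \<open>f\<close>.\<close>

definition D :: "nat set \<Rightarrow> real" where
  "D S = avg C (\<lambda>e. W (signed_ind e S))"

lemma per_add: "f (torus_rep M n x + v) = f (x + v)"
  by (metis per torus_rep_add)

lemma W_nonneg: "W v \<ge> 0"
  by (simp add: W_def avg_nonneg)

lemma D_nonneg: "D S \<ge> 0"
  by (simp add: D_def avg_nonneg W_nonneg)

lemma avg_shift_diff: "avg T (\<lambda>x. \<bar>f (x + a) - f (x + b)\<bar> powr p) = W (a - b)"
proof -
  have "avg T (\<lambda>x. \<bar>f (x + b + (a - b)) - f (x + b)\<bar> powr p) = W (a - b)"
    unfolding W_def by (rule avg_torus_shift[OF M]) (simp only: per per_add)
  then show ?thesis by (simp add: add.assoc)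
qed

lemma W_minus: "W (- v) = W v"
  using avg_shift_diff[of 0 v] by (simp add: W_def abs_minus_commute)

lemma W_add: "W (a + b) \<le> 2 powr p * (W a + W b)"
proof -
  have "W (a + b) \<le> avg T (\<lambda>x. 2 powr p * (\<bar>f (x + (a + b)) - f (x + b)\<bar> powr p
      + \<bar>f (x + b) - f x\<bar> powr p))"
    unfolding W_def
  proof (intro avg_mono)
    fix x
    show "\<bar>f (x + (a + b)) - f x\<bar> powr p \<le> 2 powr p * (\<bar>f (x + (a + b)) - f (x + b)\<bar> powr p
      + \<bar>f (x + b) - f x\<bar> powr p)"
      using abs_add_powr_le[of p "f (x + (a + b)) - f (x + b)" "f (x + b) - f x"] p by simp
  qed
  also have "\<dots> = 2 powr p * (W a + W b)"
    using avg_shift_diff[of "a + b" b] by (simp add: avg_cmult avg_add) (simp add: W_def)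
  finally show ?thesis .
qed

text \<open>Both \<open>e\<close> and its resampled version are a signed indicator of \<open>S\<close> away from
  \<open>e - signed_ind e S\<close>.\<close>

lemma resample_le:
  assumes "R \<subseteq> S"
  shows "avg C (\<lambda>e. avg C (\<lambda>d. W (e - override_on e d R))) \<le> 2 * 2 powr p * D S"
proof -
  have "avg C (\<lambda>e. avg C (\<lambda>d. W (e - override_on e d R)))
      \<le> avg C (\<lambda>e. avg C (\<lambda>d. 2 powr p
        * (W (signed_ind e S) + W (signed_ind (override_on e d R) S))))"
  proof (intro avg_mono)
    fix e d :: "nat \<Rightarrow> int"
    have "e - override_on e d R = signed_ind e S + - signed_ind (override_on e d R) S"
      using assms by (intro ext) (auto simp: signed_ind_def override_on_def)
    then show "W (e - override_on e d R)
        \<le> 2 powr p * (W (signed_ind e S) + W (signed_ind (override_on e d R) S))"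
      using W_add[of "signed_ind e S" "- signed_ind (override_on e d R) S"] by (simp only: W_minus)
  qed
  also have "\<dots> = 2 * 2 powr p * D S"
    using avg_cube_override[of n "\<lambda>e. W (signed_ind e S)" R]
    by (simp add: avg_cmult avg_add avg_const D_def)
  finally show ?thesis .
qed

text \<open>Both values are compared with the mean over signs, and \<open>- e\<close> has the law of
  \<open>e\<close>. This comparison and \<open>resample_le\<close> each cost
  \<open>2 * 2 powr p\<close>.\<close>

lemma antipodal_cover_bound:
  assumes cover: "{..<n} = (\<Union>j<N. S j)"
  shows "avg T (\<lambda>x. avg C (\<lambda>e. \<bar>f (x + e) - f (x - e)\<bar> powr p))
    \<le> 4 * 4 powr p * (real N powr (p / 2 - 1) * ((8 * p) powr (p / 2) * (\<Sum>i<N. D (S i))))"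
proof -
  let ?R = "\<lambda>i. S i - (\<Union>j<i. S j)"
  let ?\<mu> = "\<lambda>x. avg C (\<lambda>e. f (x + e))"
  let ?c = "real N powr (p / 2 - 1)" and ?K = "(8 * p) powr (p / 2)"
  let ?B = "\<lambda>x i. avg C (\<lambda>e. avg C (\<lambda>d. \<bar>f (x + e) - f (x + override_on e d (?R i))\<bar> powr p))"
  have pointwise: "avg C (\<lambda>e. \<bar>f (x + e) - f (x - e)\<bar> powr p)
      \<le> 2 * 2 powr p * (?c * (?K * (\<Sum>i<N. ?B x i)))" for x
  proof -
    let ?neg = "\<lambda>e. restrict (- e) {..<n}"
    \<comment> \<open>Restricting \<open>- e\<close> changes it only outside \<open>{..<n}\<close>,
      where \<open>f\<close> is blind by periodicity.\<close>
    have neg: "f (x - e) = f (x + ?neg e)" for e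
      by (subst (1 2) per[symmetric]) (simp add: torus_rep_def restrict_def cong: if_cong)
    have "avg C (\<lambda>e. \<bar>f (x + e) - f (x - e)\<bar> powr p)
        \<le> avg C (\<lambda>e. 2 powr p * (\<bar>f (x + e) - ?\<mu> x\<bar> powr p + \<bar>f (x + ?neg e) - ?\<mu> x\<bar> powr p))"
    proof (intro avg_mono)
      fix e
      show "\<bar>f (x + e) - f (x - e)\<bar> powr p
        \<le> 2 powr p * (\<bar>f (x + e) - ?\<mu> x\<bar> powr p + \<bar>f (x + ?neg e) - ?\<mu> x\<bar> powr p)"
        using abs_add_powr_le[of p "f (x + e) - ?\<mu> x" "?\<mu> x - f (x + ?neg e)"] p
        by (simp add: neg abs_minus_commute)
    qed
    also have "\<dots> = 2 * 2 powr p * avg C (\<lambda>e. \<bar>f (x + e) - ?\<mu> x\<bar> powr p)"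
      using avg_cube_neg[of n "\<lambda>e. \<bar>f (x + e) - ?\<mu> x\<bar> powr p"]
      by (simp add: avg_cmult avg_add)
    also have "\<dots> \<le> 2 * 2 powr p * (?c * (?K * (\<Sum>i<N. ?B x i)))"
      using cover by (intro mult_left_mono cube_concentration p) auto
    finally show ?thesis .
  qed
  have B: "avg T (\<lambda>x. ?B x i) \<le> 2 * 2 powr p * D (S i)" for i
  proof -
    have "avg T (\<lambda>x. ?B x i) = avg C (\<lambda>e. avg C (\<lambda>d.
        avg T (\<lambda>x. \<bar>f (x + e) - f (x + override_on e d (?R i))\<bar> powr p)))"
      by (subst avg_swap, subst avg_swap[of T]) (rule refl)
    also have "\<dots> \<le> 2 * 2 powr p * D (S i)"
      unfolding avg_shift_diff by (rule resample_le) auto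
    finally show ?thesis .
  qed
  have "avg T (\<lambda>x. avg C (\<lambda>e. \<bar>f (x + e) - f (x - e)\<bar> powr p))
      \<le> avg T (\<lambda>x. 2 * 2 powr p * (?c * (?K * (\<Sum>i<N. ?B x i))))"
    by (intro avg_mono pointwise)
  also have "\<dots> = 2 * 2 powr p * (?c * (?K * (\<Sum>i<N. avg T (\<lambda>x. ?B x i))))"
    by (simp only: avg_cmult avg_sum)
  also have "\<dots> \<le> 2 * 2 powr p * (?c * (?K * (\<Sum>i<N. 2 * 2 powr p * D (S i))))"
    by (intro mult_left_mono sum_mono B) auto
  also have "\<dots> = 4 * (2 powr p * 2 powr p) * (?c * (?K * (\<Sum>i<N. D (S i))))"
    by (simp add: sum_distrib_left[symmetric])
  also have "2 powr p * 2 powr p = (4 powr p :: real)"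
    by (simp flip: powr_mult)
  finally show ?thesis .
qed

text \<open>The left-hand side does not depend on the cover, so the bound may be averaged over all
  permuted covers; each set then becomes a uniform k-subset.\<close>

lemma antipodal_bound:
  assumes k: "1 \<le> k" "k \<le> n"
  shows "(real k / real n) powr (p / 2) * avg T (\<lambda>x. avg C (\<lambda>e. \<bar>f (x + e) - f (x - e)\<bar> powr p))
    \<le> 64 powr p * (p powr (p / 2) * avg {S. S \<subseteq> {..<n} \<and> card S = k} D)"
proof -
  let ?K = "{S. S \<subseteq> {..<n} \<and> card S = k}" and ?P = "{\<pi>. \<pi> permutes {..<n}}"
  let ?X = "avg T (\<lambda>x. avg C (\<lambda>e. \<bar>f (x + e) - f (x - e)\<bar> powr p))"
  obtain S :: "nat \<Rightarrow> nat set" and N where N: "N > 0" "N * k \<le> 2 * n"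
    and cover: "{..<n} = (\<Union>i<N. S i)" and S: "\<And>i. S i \<subseteq> {..<n} \<and> card (S i) = k"
    using cover_by_k_sets[OF k] by metis
  have fin: "finite ?P" "?P \<noteq> {}"
    using permutes_id[of "{..<n}"] by (auto simp: finite_permutations simp del: permutes_id)
  let ?c = "4 * 4 powr p * (real N powr (p / 2 - 1) * (8 * p) powr (p / 2))"
  have "?X = avg ?P (\<lambda>\<pi>. ?X)" using fin by (simp add: avg_const)
  also have "\<dots> \<le> avg ?P (\<lambda>\<pi>. ?c * (\<Sum>i<N. D (\<pi> ` S i)))"
  proof (intro avg_mono)
    fix \<pi> assume "\<pi> \<in> ?P"
    then have "{..<n} = (\<Union>i<N. \<pi> ` S i)"
      using permutes_image[of \<pi> "{..<n}"] by (simp add: cover image_UN)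
    from antipodal_cover_bound[OF this] show "?X \<le> ?c * (\<Sum>i<N. D (\<pi> ` S i))"
      by (simp add: mult.assoc)
  qed
  also have "\<dots> = ?c * (\<Sum>i<N. avg ?P (\<lambda>\<pi>. D (\<pi> ` S i)))"
    by (simp only: avg_cmult avg_sum)
  also have "\<dots> = ?c * (real N * avg ?K D)"
    using S by (simp add: avg_permutes_image[of "{..<n}" _ k])
  also have "\<dots> = 4 * 4 powr p * (real N powr (p / 2) * (8 * p) powr (p / 2) * avg ?K D)"
    using N by (simp add: powr_diff)
  finally have "(real k / real n) powr (p / 2) * ?X \<le> (real k / real n) powr (p / 2)
      * (4 * 4 powr p * (real N powr (p / 2) * (8 * p) powr (p / 2) * avg ?K D))"
    by (intro mult_left_mono) auto
  also have "\<dots> = 4 * 4 powr p * ((8 * (real k / real n * real N)) powr (p / 2)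
      * p powr (p / 2) * avg ?K D)"
    using p by (simp add: powr_mult powr_divide)
  \<comment> \<open>Here 16 is 8 times 2, from \<open>N * k \<le> 2 * n\<close>; its power p/2 is
    4^p.\<close>
  also have "\<dots> \<le> 4 * 4 powr p * (16 powr (p / 2) * p powr (p / 2) * avg ?K D)"
  proof (intro mult_left_mono mult_right_mono powr_mono2)
    have "real N * real k \<le> 2 * real n"
      using N(2) by (metis of_nat_mult of_nat_le_iff of_nat_numeral)
    then show "8 * (real k / real n * real N) \<le> 16"
      using k by (simp add: field_simps)
  qed (use p in \<open>auto intro: avg_nonneg D_nonneg\<close>)
  also have "\<dots> = 4 * (4 powr p * 4 powr p) * (p powr (p / 2) * avg ?K D)"
    using abs_powr_eq_square_powr[of 4 p] by simp
  also have "\<dots> \<le> 4 powr p * (4 powr p * 4 powr p) * (p powr (p / 2) * avg ?K D)"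
    using p powr_mono[of 1 p 4]
    by (intro mult_right_mono mult_nonneg_nonneg) (auto intro: avg_nonneg D_nonneg)
  also have "4 powr p * (4 powr p * 4 powr p) = (64 powr p :: real)"
    by (simp flip: powr_mult)
  finally show ?thesis .
qed

end

section \<open>The axis term\<close>

definition axis_vec :: "int \<Rightarrow> nat \<Rightarrow> nat \<Rightarrow> int" where
  "axis_vec c j = (\<lambda>i. if i = j then c else 0)"

context torus_function
begin

definition coef :: "nat set \<Rightarrow> nat \<Rightarrow> (nat \<Rightarrow> int) \<Rightarrow> real" where
  "coef S j x = avg C (\<lambda>e. real_of_int (e j) * f (x + signed_ind e S))"

text \<open>In \<open>half_smooth\<close> the coordinate \<open>j\<close> carries a fixed sign and the others are averaged: for
  \<open>j \<in> S\<close> it is then an average of \<open>f\<close> over points at a distance controlled by \<open>D S\<close>, and its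
  increments along \<open>2 e\<^sub>j\<close> are degree-one Fourier coefficients.\<close>

definition half_smooth :: "nat set \<Rightarrow> nat \<Rightarrow> (nat \<Rightarrow> int) \<Rightarrow> real" where
  "half_smooth S j x = avg C (\<lambda>e. f (x + signed_ind (e(j := -1)) S))"

lemma half_smooth_step:
  assumes "j \<in> S" "j < n"
  shows "half_smooth S j (x + axis_vec 2 j) - half_smooth S j x = 2 * coef S j x"
proof -
  have eq: "x + axis_vec 2 j + signed_ind (e(j := -1)) S = x + signed_ind (e(j := 1)) S" for e
    using assms by (intro ext) (auto simp: axis_vec_def signed_ind_def)
  then show ?thesis
    using avg_cube_sign[OF assms(2), of "\<lambda>e. f (x + signed_ind e S)"]
    unfolding half_smooth_def coef_def eq by simp
qed

lemma half_smooth_telescope: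
  assumes "j \<in> S" "j < n"
  shows "half_smooth S j (x + axis_vec (2 * int N) j) - half_smooth S j x
    = (\<Sum>s<N. 2 * coef S j (x + axis_vec (2 * int s) j))"
proof (induction N)
  case 0
  have "x + axis_vec 0 j = x" by (intro ext) (simp add: axis_vec_def)
  then show ?case by simp
next
  case (Suc N)
  have eq: "x + axis_vec (2 * int (Suc N)) j = x + axis_vec (2 * int N) j + axis_vec 2 j"
    by (intro ext) (simp add: axis_vec_def)
  show ?case
    using Suc.IH half_smooth_step[OF assms, of "x + axis_vec (2 * int N) j"]
    unfolding eq sum.lessThan_Suc by linarith
qed

text \<open>The shift by 4m consists of 2m steps of length 2, each twice a coefficient. By
  translation invariance all steps have the same moment.\<close>

lemma avg_telescope_le:
  assumes "j \<in> S" "j < n" "m > 0"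
  shows "avg T (\<lambda>x. \<bar>half_smooth S j (x + axis_vec (4 * int m) j) - half_smooth S j x\<bar> powr p)
    \<le> (4 * real m) powr p * avg T (\<lambda>x. \<bar>coef S j x\<bar> powr p)"
proof -
  let ?A = "avg T (\<lambda>x. \<bar>coef S j x\<bar> powr p)"
  have shift: "avg T (\<lambda>x. \<bar>coef S j (x + v)\<bar> powr p) = ?A" for v
    by (rule avg_torus_shift[OF M]) (simp only: coef_def per_add)
  have "avg T (\<lambda>x. \<bar>half_smooth S j (x + axis_vec (4 * int m) j) - half_smooth S j x\<bar> powr p)
      \<le> avg T (\<lambda>x. real (2 * m) powr (p - 1)
        * (\<Sum>s<2 * m. 2 powr p * \<bar>coef S j (x + axis_vec (2 * int s) j)\<bar> powr p))"
  proof (intro avg_mono)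
    fix x
    show "\<bar>half_smooth S j (x + axis_vec (4 * int m) j) - half_smooth S j x\<bar> powr p
      \<le> real (2 * m) powr (p - 1)
        * (\<Sum>s<2 * m. 2 powr p * \<bar>coef S j (x + axis_vec (2 * int s) j)\<bar> powr p)"
      using half_smooth_telescope[OF assms(1,2), of x "2 * m"] p assms(3)
        sum_powr_le[of "{..<2 * m}" p "\<lambda>s. 2 * coef S j (x + axis_vec (2 * int s) j)"]
      by (simp add: abs_mult powr_mult lessThan_empty_iff)
  qed
  also have "\<dots> = real (2 * m) powr (p - 1) * (real (2 * m) * (2 powr p * ?A))"
    by (simp only: avg_cmult avg_sum shift) simp
  also have "\<dots> = (real (2 * m) powr (p - 1) * real (2 * m)) * 2 powr p * ?A" by simp
  also have "real (2 * m) powr (p - 1) * real (2 * m) = real (2 * m) powr p"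
    using assms(3) by (simp add: powr_diff)
  also have "real (2 * m) powr p * 2 powr p = (4 * real m) powr p"
    by (simp flip: powr_mult)
  finally show ?thesis .
qed

text \<open>Jensen's inequality, with a factor 2 for fixing the sign at \<open>j\<close>.\<close>

lemma half_smooth_error:
  assumes "j < n"
  shows "avg T (\<lambda>x. \<bar>half_smooth S j x - f x\<bar> powr p) \<le> 2 * D S"
proof -
  have "avg T (\<lambda>x. \<bar>half_smooth S j x - f x\<bar> powr p)
      \<le> avg T (\<lambda>x. avg C (\<lambda>e. \<bar>f (x + signed_ind (e(j := -1)) S) - f x\<bar> powr p))"
  proof (intro avg_mono)
    fix x
    show "\<bar>half_smooth S j x - f x\<bar> powr p
        \<le> avg C (\<lambda>e. \<bar>f (x + signed_ind (e(j := -1)) S) - f x\<bar> powr p)"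
      using avg_jensen[of C p "\<lambda>e. f (x + signed_ind (e(j := -1)) S) - f x"] p
      by (simp add: avg_diff avg_const half_smooth_def)
  qed
  also have "\<dots> = avg C (\<lambda>e. W (signed_ind (e(j := -1)) S))"
    unfolding W_def by (rule avg_swap)
  also have "\<dots> \<le> 2 * D S"
    unfolding D_def
    by (rule avg_cube_fix_le[OF assms, of "\<lambda>e. W (signed_ind e S)"]) (rule W_nonneg)
  finally show ?thesis .
qed

text \<open>Replace \<open>f\<close> by \<open>half_smooth S j\<close> at both endpoints; by
  translation invariance the two errors have equal moments.\<close>

lemma axis_step_le:
  assumes "j \<in> S" "j < n" "m > 0"
  shows "W (axis_vec (4 * int m) j)
    \<le> 3 powr p * (4 * D S + (4 * real m) powr p * avg T (\<lambda>x. \<bar>coef S j x\<bar> powr p))"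
proof -
  let ?h = "half_smooth S j" and ?v = "axis_vec (4 * int m) j"
  have shift: "avg T (\<lambda>x. \<bar>?h (x + ?v) - f (x + ?v)\<bar> powr p) = avg T (\<lambda>x. \<bar>?h x - f x\<bar> powr p)"
    by (rule avg_torus_shift[OF M]) (simp only: half_smooth_def per_add per)
  have "W ?v \<le> avg T (\<lambda>x. 3 powr p * (\<bar>?h (x + ?v) - f (x + ?v)\<bar> powr p
      + \<bar>?h (x + ?v) - ?h x\<bar> powr p + \<bar>?h x - f x\<bar> powr p))"
    unfolding W_def
  proof (intro avg_mono)
    fix x
    show "\<bar>f (x + ?v) - f x\<bar> powr p \<le> 3 powr p * (\<bar>?h (x + ?v) - f (x + ?v)\<bar> powr p
      + \<bar>?h (x + ?v) - ?h x\<bar> powr p + \<bar>?h x - f x\<bar> powr p)"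
      using abs_add3_powr_le[of p "f (x + ?v) - ?h (x + ?v)" "?h (x + ?v) - ?h x" "?h x - f x"] p
      by (simp add: abs_minus_commute)
  qed
  also have "\<dots> = 3 powr p * (avg T (\<lambda>x. \<bar>?h x - f x\<bar> powr p)
      + avg T (\<lambda>x. \<bar>?h (x + ?v) - ?h x\<bar> powr p) + avg T (\<lambda>x. \<bar>?h x - f x\<bar> powr p))"
    by (simp only: avg_cmult avg_add shift)
  also have "\<dots> \<le> 3 powr p * (4 * D S + (4 * real m) powr p * avg T (\<lambda>x. \<bar>coef S j x\<bar> powr p))"
    using half_smooth_error[OF assms(2), of S] avg_telescope_le[OF assms]
    by (intro mult_left_mono) auto
  finally show ?thesis .
qed

text \<open>Sign functions have mean zero, so \<open>f x\<close> may be subtracted inside each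
  coefficient before \<open>cube_cotype\<close> is applied at every \<open>x\<close>.\<close>

lemma sum_coef_le:
  assumes S: "S \<subseteq> {..<n}"
  shows "(\<Sum>j\<in>S. avg T (\<lambda>x. \<bar>coef S j x\<bar> powr p)) \<le> D S"
proof -
  have coef: "coef S j x = avg C (\<lambda>e. real_of_int (e j) * (f (x + signed_ind e S) - f x))"
    if "j < n" for j x
    using avg_cube_sign[OF that, of "\<lambda>e. f x"] by (simp add: coef_def right_diff_distrib avg_diff)
  have "(\<Sum>j\<in>S. avg T (\<lambda>x. \<bar>coef S j x\<bar> powr p)) = avg T (\<lambda>x. \<Sum>j\<in>S. \<bar>coef S j x\<bar> powr p)"
    by (simp add: avg_sum)
  also have "\<dots> \<le> avg T (\<lambda>x. avg C (\<lambda>e. \<bar>f (x + signed_ind e S) - f x\<bar> powr p))"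
  proof (intro avg_mono)
    fix x
    show "(\<Sum>j\<in>S. \<bar>coef S j x\<bar> powr p) \<le> avg C (\<lambda>e. \<bar>f (x + signed_ind e S) - f x\<bar> powr p)"
      using cube_cotype[OF S p, of "\<lambda>e. f (x + signed_ind e S) - f x"] S
      by (simp add: coef subset_iff cong: sum.cong)
  qed
  also have "\<dots> = D S"
    unfolding D_def W_def by (rule avg_swap)
  finally show ?thesis .
qed

lemma axis_bound:
  assumes k: "1 \<le> k" "k \<le> n" and m: "m > 0" and km: "real k \<le> real m powr p * p powr (p / 2)"
  shows "real k / real n * (\<Sum>j<n. W (axis_vec (4 * int m) j) / real m powr p)
    \<le> 64 powr p * (p powr (p / 2) * avg {S. S \<subseteq> {..<n} \<and> card S = k} D)"
proof -
  let ?K = "{S. S \<subseteq> {..<n} \<and> card S = k}" and ?w = "\<lambda>j. W (axis_vec (4 * int m) j)"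
  let ?q = "p powr (p / 2)" and ?m = "real m powr p"
  have m_pos: "?m > 0" using m by simp
  have step: "(\<Sum>j\<in>S. ?w j / ?m) \<le> 64 powr p * ?q * D S" if S: "S \<in> ?K" for S
  proof -
    have "(\<Sum>j\<in>S. ?w j) \<le> (\<Sum>j\<in>S. 3 powr p * (4 * D S
        + (4 * real m) powr p * avg T (\<lambda>x. \<bar>coef S j x\<bar> powr p)))"
      using S m by (intro sum_mono axis_step_le) auto
    also have "\<dots> = 3 powr p * (4 * real k * D S
        + (4 powr p * ?m) * (\<Sum>j\<in>S. avg T (\<lambda>x. \<bar>coef S j x\<bar> powr p)))"
      using S by (simp add: sum_distrib_left[symmetric] sum.distrib powr_mult)
    \<comment> \<open>The error occurs \<open>k\<close> times and is absorbed by \<open>km\<close>;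
      the coefficients together cost a single \<open>D S\<close>.\<close>
    also have "\<dots> \<le> 3 powr p * (4 * (?m * ?q) * D S + (4 powr p * ?m) * D S)"
      using S km sum_coef_le[of S]
      by (intro mult_left_mono add_mono mult_right_mono D_nonneg) auto
    also have "\<dots> = ?m * (3 powr p * (4 * ?q + 4 powr p) * D S)"
      by (simp add: algebra_simps)
    also have "\<dots> \<le> ?m * (64 powr p * ?q * D S)"
    proof (intro mult_left_mono mult_right_mono D_nonneg)
      have "4 * ?q \<le> 4 powr p * ?q"
        using p powr_mono[of 1 p 4] by (intro mult_right_mono) auto
      moreover have "4 powr p * 1 \<le> 4 powr p * ?q"
        using p by (intro mult_left_mono ge_one_powr_ge_zero) auto
      ultimately have "3 powr p * (4 * ?q + 4 powr p) \<le> 3 powr p * (2 * (4 powr p * ?q))"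
        by (intro mult_left_mono) (linarith, simp)
      also have "\<dots> \<le> 3 powr p * (2 powr p * (4 powr p * ?q))"
        using p powr_mono[of 1 p 2] by (intro mult_left_mono mult_right_mono) auto
      also have "\<dots> = 24 powr p * ?q"
        by (simp add: mult.assoc[symmetric] flip: powr_mult)
      also have "\<dots> \<le> 64 powr p * ?q"
        using p by (intro mult_right_mono powr_mono2) auto
      finally show "3 powr p * (4 * ?q + 4 powr p) \<le> 64 powr p * ?q" .
    qed auto
    finally show ?thesis
      using m_pos by (simp add: sum_divide_distrib[symmetric] divide_le_eq mult.commute)
  qed
  have "real k / real n * (\<Sum>j<n. ?w j / ?m) = avg ?K (\<lambda>S. \<Sum>j\<in>S. ?w j / ?m)"
    by (rule avg_subsets_sum[OF k, symmetric])
  also have "\<dots> \<le> avg ?K (\<lambda>S. 64 powr p * ?q * D S)"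
    by (rule avg_mono[OF step])
  also have "\<dots> = 64 powr p * (?q * avg ?K D)"
    by (simp only: avg_cmult mult.assoc)
  finally show ?thesis .
qed

lemma scalar_bound:
  assumes k: "1 \<le> k" "k \<le> n" and m: "m > 0" and km: "real k \<le> real m powr p * p powr (p / 2)"
  shows "real k / real n * (\<Sum>j<n. W (axis_vec (4 * int m) j) / real m powr p)
      + (real k / real n) powr (p / 2)
        * avg T (\<lambda>x. avg C (\<lambda>e. \<bar>f (x + e) - f (x - e)\<bar> powr p))
    \<le> 128 powr p * (p powr (p / 2) / real (n choose k)
        * (\<Sum>S\<in>{S. S \<subseteq> {..<n} \<and> card S = k}. D S))"
proof -
  let ?K = "{S. S \<subseteq> {..<n} \<and> card S = k}"
  let ?Q = "p powr (p / 2) * avg ?K D"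
  have "real k / real n * (\<Sum>j<n. W (axis_vec (4 * int m) j) / real m powr p)
      + (real k / real n) powr (p / 2)
        * avg T (\<lambda>x. avg C (\<lambda>e. \<bar>f (x + e) - f (x - e)\<bar> powr p))
    \<le> 64 powr p * ?Q + 64 powr p * ?Q"
    by (intro add_mono axis_bound antipodal_bound assms)
  also have "\<dots> = 2 * (64 powr p * ?Q)" by simp
  also have "\<dots> \<le> 2 powr p * (64 powr p * ?Q)"
    using p powr_mono[of 1 p 2]
    by (intro mult_right_mono mult_nonneg_nonneg) (auto intro: avg_nonneg D_nonneg)
  also have "\<dots> = 128 powr p * ?Q"
    by (simp add: mult.assoc[symmetric] flip: powr_mult)
  also have "?Q = p powr (p / 2) / real (n choose k) * (\<Sum>S\<in>?K. D S)"
    using n_subsets[of "{..<n}" k] by (simp add: avg_def)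
  finally show ?thesis .
qed

end

section \<open>Integration over the unit interval\<close>

lemma has_bochner_integral_avg:
  assumes "\<And>a. a \<in> A \<Longrightarrow> has_bochner_integral N (\<lambda>t. g a t) (I a)"
  shows "has_bochner_integral N (\<lambda>t. avg A (\<lambda>a. g a t)) (avg A I)"
  unfolding avg_def using assms by (intro has_bochner_integral_divide_zero has_bochner_integral_sum)

lemma Lp_dist_pow_integral:
  assumes "in_Lp p g" "in_Lp p h" "p \<ge> 1"
  shows "has_bochner_integral (lebesgue_on {0..1}) (\<lambda>t. \<bar>g t - h t\<bar> powr p) (Lp_dist_pow p g h)"
proof -
  let ?N = "lebesgue_on {0..1::real}"
  have meas [measurable]: "g \<in> borel_measurable ?N" "h \<in> borel_measurable ?N"
    using assms by (auto simp: in_Lp_def)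
  have "integrable ?N (\<lambda>t. \<bar>g t - h t\<bar> powr p)"
  proof (rule Bochner_Integration.integrable_bound)
    show "integrable ?N (\<lambda>t. 2 powr p * (\<bar>g t\<bar> powr p + \<bar>h t\<bar> powr p))"
      using assms by (auto simp: in_Lp_def)
    show "AE t in ?N. norm (\<bar>g t - h t\<bar> powr p) \<le> norm (2 powr p * (\<bar>g t\<bar> powr p + \<bar>h t\<bar> powr p))"
      using abs_add_powr_le[OF assms(3), of _ "- _"] by (intro AE_I2) auto
  qed measurable
  then show ?thesis
    unfolding Lp_dist_pow_def by (simp add: has_bochner_integral_iff)
qed

lemma tadd_eq_torus_rep: "tadd M n x v = torus_rep M n (x + v)"
  by (simp add: tadd_def torus_rep_def)

lemma tsub_eq_torus_rep: "tsub M n x v = torus_rep M n (x - v)"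
  by (simp add: tsub_def torus_rep_def)

lemma tadd_epsS: "tadd M n x (epsS n e S) = torus_rep M n (x + signed_ind e S)"
  by (rule ext) (simp add: tadd_def epsS_def torus_rep_def signed_ind_def restrict_def)

lemma tadd_svec: "tadd M n x (svec n c j) = torus_rep M n (x + axis_vec c j)"
  by (rule ext) (simp add: tadd_def svec_def torus_rep_def axis_vec_def restrict_def)

text \<open>Both sides are integrals over t, and \<open>scalar_bound\<close> compares the integrands
  pointwise.\<close>

lemma Lp_bound:
  fixes f :: "(nat \<Rightarrow> int) \<Rightarrow> real \<Rightarrow> real"
  assumes p: "p \<ge> 2" and k: "1 \<le> k" "k \<le> n" and m: "m > 0"
    and km: "real k \<le> real m powr p * p powr (p / 2)"
    and Lp: "\<And>x. x \<in> torus (8 * m) n \<Longrightarrow> in_Lp p (f x)"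
  shows "(real k / real n) *
        (\<Sum>j<n. avg (torus (8 * m) n)
            (\<lambda>x. Lp_dist_pow p (f (tadd (8 * m) n x (svec n (4 * int m) j))) (f x))
          / real m powr p)
      + (real k / real n) powr (p / 2) *
        avg (torus (8 * m) n \<times> cube n)
          (\<lambda>(x, \<epsilon>). Lp_dist_pow p (f (tadd (8 * m) n x \<epsilon>)) (f (tsub (8 * m) n x \<epsilon>)))
      \<le> 128 powr p * (p powr (p / 2) / real (n choose k) *
        (\<Sum>S\<in>{S. S \<subseteq> {..<n} \<and> card S = k}.
          avg (torus (8 * m) n \<times> cube n)
            (\<lambda>(x, \<epsilon>). Lp_dist_pow p (f (tadd (8 * m) n x (epsS n \<epsilon> S))) (f x))))"
    (is "?lhs \<le> ?rhs")
proof -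
  let ?N = "lebesgue_on {0..1::real}" and ?r = "torus_rep (8 * m) n"
  let ?T = "torus (8 * m) n" and ?C = "cube n" and ?K = "{S. S \<subseteq> {..<n} \<and> card S = k}"
  \<comment> \<open>Since \<open>f\<close> is arbitrary off the torus, inserting \<open>?r\<close>
    makes it periodic and agrees with \<open>f\<close> on the torus.\<close>
  let ?d = "\<lambda>x y t. \<bar>f (?r x) t - f (?r y) t\<bar> powr p"
  define L where "L t = (real k / real n) *
        (\<Sum>j<n. avg ?T (\<lambda>x. ?d (x + axis_vec (4 * int m) j) x t) / real m powr p)
      + (real k / real n) powr (p / 2) * avg ?T (\<lambda>x. avg ?C (\<lambda>e. ?d (x + e) (x - e) t))" for t
  define R where "R t = 128 powr p * (p powr (p / 2) / real (n choose k) *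
        (\<Sum>S\<in>?K. avg ?T (\<lambda>x. avg ?C (\<lambda>e. ?d (x + signed_ind e S) x t))))" for t
  have d: "has_bochner_integral ?N (?d x y) (Lp_dist_pow p (f (?r x)) (f (?r y)))" for x y
    using p m by (intro Lp_dist_pow_integral Lp torus_rep_in) auto
  have cong1: "avg ?T (\<lambda>x. Lp_dist_pow p (f (?r (g x))) (f x))
      = avg ?T (\<lambda>x. Lp_dist_pow p (f (?r (g x))) (f (?r x)))" for g
    by (intro avg_cong) (simp add: torus_rep_id)
  have cong2: "avg ?T (\<lambda>x. avg ?C (\<lambda>e. Lp_dist_pow p (f (?r (g x e))) (f x)))
      = avg ?T (\<lambda>x. avg ?C (\<lambda>e. Lp_dist_pow p (f (?r (g x e))) (f (?r x))))" for g
    by (intro avg_cong) (simp add: torus_rep_id)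
  have L: "has_bochner_integral ?N L ?lhs"
    unfolding L_def avg_Times tadd_svec unfolding tadd_eq_torus_rep tsub_eq_torus_rep cong1
    by (intro has_bochner_integral_add has_bochner_integral_mult_right has_bochner_integral_sum
        has_bochner_integral_divide_zero has_bochner_integral_avg d)
  have R: "has_bochner_integral ?N R ?rhs"
    unfolding R_def avg_Times tadd_epsS cong2
    by (intro has_bochner_integral_mult_right has_bochner_integral_sum
        has_bochner_integral_avg d)
  have "L t \<le> R t" for t
  proof -
    interpret torus_function "8 * m" n "\<lambda>x. f (?r x) t" p
      using p m by unfold_locales (simp_all add: torus_rep_id torus_rep_in)
    have "(\<Sum>S\<in>?K. D S) = (\<Sum>S\<in>?K. avg ?T (\<lambda>x. avg ?C (\<lambda>e. ?d (x + signed_ind e S) x t)))"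
      unfolding D_def W_def by (intro sum.cong refl avg_swap)
    then show ?thesis
      using scalar_bound[OF k m km] by (simp add: L_def R_def W_def)
  qed
  then show ?thesis
    using integral_mono[of ?N L R] L R by (auto simp: has_bochner_integral_iff)
qed

theorem mainTheorem3:
  shows "\<exists>c::real. c > 0 \<and>
    (\<forall>(p::real) (k::nat) (m::nat) (n::nat) (f::(nat \<Rightarrow> int) \<Rightarrow> real \<Rightarrow> real).
      p \<ge> 2 \<longrightarrow> real m \<ge> real k powr (1 / p) / sqrt p \<longrightarrow> n \<ge> k \<longrightarrow>
      (\<forall>x\<in>torus (8 * m) n. in_Lp p (f x)) \<longrightarrow>
      (real k / real n) *
        (\<Sum>j<n. avg (torus (8 * m) n)
            (\<lambda>x. Lp_dist_pow p (f (tadd (8 * m) n x (svec n (4 * int m) j))) (f x))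
          / real m powr p)
      + (real k / real n) powr (p / 2) *
        avg (torus (8 * m) n \<times> cube n)
          (\<lambda>(x, \<epsilon>). Lp_dist_pow p (f (tadd (8 * m) n x \<epsilon>)) (f (tsub (8 * m) n x \<epsilon>)))
      \<le> c powr p * (p powr (p / 2) / real (n choose k) *
        (\<Sum>S\<in>{S. S \<subseteq> {..<n} \<and> card S = k}.
          avg (torus (8 * m) n \<times> cube n)
            (\<lambda>(x, \<epsilon>). Lp_dist_pow p (f (tadd (8 * m) n x (epsS n \<epsilon> S))) (f x)))))"
proof (intro exI[of _ "128::real"] conjI allI impI)
  fix p :: real and k m n :: nat and f :: "(nat \<Rightarrow> int) \<Rightarrow> real \<Rightarrow> real"
  assume p: "p \<ge> 2" and mk: "real m \<ge> real k powr (1 / p) / sqrt p" and kn: "n \<ge> k"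
    and Lp: "\<forall>x\<in>torus (8 * m) n. in_Lp p (f x)"
  show "(real k / real n) *
        (\<Sum>j<n. avg (torus (8 * m) n)
            (\<lambda>x. Lp_dist_pow p (f (tadd (8 * m) n x (svec n (4 * int m) j))) (f x))
          / real m powr p)
      + (real k / real n) powr (p / 2) *
        avg (torus (8 * m) n \<times> cube n)
          (\<lambda>(x, \<epsilon>). Lp_dist_pow p (f (tadd (8 * m) n x \<epsilon>)) (f (tsub (8 * m) n x \<epsilon>)))
      \<le> 128 powr p * (p powr (p / 2) / real (n choose k) *
        (\<Sum>S\<in>{S. S \<subseteq> {..<n} \<and> card S = k}.
          avg (torus (8 * m) n \<times> cube n)
            (\<lambda>(x, \<epsilon>). Lp_dist_pow p (f (tadd (8 * m) n x (epsS n \<epsilon> S))) (f x))))"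
  proof (cases "k = 0")
    \<comment> \<open>Here \<open>m\<close> may be 0, but both factors k/n and (k/n)^(p/2) vanish
      and the right-hand side is nonnegative.\<close>
    case True
    have "0 \<le> 128 powr p * (p powr (p / 2) / real (n choose k) *
        (\<Sum>S\<in>{S. S \<subseteq> {..<n} \<and> card S = k}.
          avg (torus (8 * m) n \<times> cube n)
            (\<lambda>(x, \<epsilon>). Lp_dist_pow p (f (tadd (8 * m) n x (epsS n \<epsilon> S))) (f x))))"
      by (intro mult_nonneg_nonneg sum_nonneg avg_nonneg)
        (auto simp: Lp_dist_pow_def intro!: integral_nonneg)
    then show ?thesis using True p by simp
  next
    case False
    have "0 < real k powr (1 / p) / sqrt p" using False p by simp
    then have m: "m > 0" using mk by simp
    \<comment> \<open>Raising the hypothesis on \<open>m\<close> to the power \<open>p\<close> gives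
      the form that \<open>Lp_bound\<close> needs.\<close>
    have "real k powr (1 / p) \<le> real m * sqrt p"
      using mk p by (simp add: divide_le_eq)
    then have "(real k powr (1 / p)) powr p \<le> (real m * sqrt p) powr p"
      using p by (intro powr_mono2) auto
    then have "real k \<le> real m powr p * p powr (p / 2)"
      using p False by (simp add: powr_powr powr_mult powr_half_sqrt[symmetric])
    then show ?thesis
      using False p kn m Lp by (intro Lp_bound) auto
  qed
qed simp

end
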